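(* For every integer $n\ge0$, $$c\phi_8(2n+1)\equiv0\pmod{64},\quad c\phi_8(4n+2)\equiv0\pmod{16},\quad c\phi_8(8n+4)\equiv0\pmod4,\quad c\phi_8(8n+6)\equiv0\pmod{64}.$$
   Context: A $k$-colored generalized Frobenius symbol is a two-row array with $d\ge 0$ columns whose entries are colored nonnegative integers $\ell_c$ ($\ell\ge 0$, color $c\in\{1,\dots,k\}$), each row strictly decreasing with respect to the total order $0_1\prec 0_2\prec\cdots\prec 0_k\prec 1_1\prec\cdots\prec 1_k\prec 2_1\prec\cdots$. It is a $k$-colored generalized Frobenius partition of $n=d+\sum(\text{integer values of all entries})$, and $c\phi_k(n)$ is the number of such partitions of $n$. *)

theory Defs
  imports "HOL-Number_Theory.Cong"
begin

(* The pair (l, c) stands for the integer l in color c. *)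
type_synonym colored_nat = "nat \<times> nat"

definition colored_less :: "colored_nat \<Rightarrow> colored_nat \<Rightarrow> bool" where
  "colored_less x y \<longleftrightarrow> fst x < fst y \<or> (fst x = fst y \<and> snd x < snd y)"

definition frobenius_row :: "nat \<Rightarrow> colored_nat list \<Rightarrow> bool" where
  "frobenius_row k r \<longleftrightarrow>
     (\<forall>x \<in> set r. snd x \<in> {1..k}) \<and> sorted_wrt (\<lambda>x y. colored_less y x) r"

(* A symbol is the pair (top row, bottom row); the common length is the number of columns. *)
definition gen_frobenius_symbol :: "nat \<Rightarrow> colored_nat list \<times> colored_nat list \<Rightarrow> bool" where
  "gen_frobenius_symbol k s \<longleftrightarrow>
     frobenius_row k (fst s) \<and> frobenius_row k (snd s) \<and> length (fst s) = length (snd s)"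

definition symbol_size :: "colored_nat list \<times> colored_nat list \<Rightarrow> nat" where
  "symbol_size s = length (fst s) + sum_list (map fst (fst s)) + sum_list (map fst (snd s))"

definition gen_frobenius_partitions :: "nat \<Rightarrow> nat \<Rightarrow> (colored_nat list \<times> colored_nat list) set" where
  "gen_frobenius_partitions k n = {s. gen_frobenius_symbol k s \<and> symbol_size s = n}"

definition c_phi :: "nat \<Rightarrow> nat \<Rightarrow> nat" where
  "c_phi k n = card (gen_frobenius_partitions k n)"

(* In particular, card in c_phi_def is the genuine number of partitions. *)
lemma finite_gen_frobenius_partitions: "finite (gen_frobenius_partitions k n)"
proof -
  let ?R = "{r. set r \<subseteq> {0..n} \<times> {1..k} \<and> length r \<le> n}"
  have row: "r \<in> ?R" if "frobenius_row k r" "length r \<le> n" "sum_list (map fst r) \<le> n" for r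
  proof -
    have "fst x \<le> n" if "x \<in> set r" for x
      using member_le_sum_list[of "fst x" "map fst r"] that \<open>sum_list (map fst r) \<le> n\<close> by auto
    then show ?thesis
      using that by (auto simp: frobenius_row_def)
  qed
  have "gen_frobenius_partitions k n \<subseteq> ?R \<times> ?R"
  proof
    fix s assume "s \<in> gen_frobenius_partitions k n"
    then have s: "frobenius_row k (fst s)" "frobenius_row k (snd s)"
        "length (fst s) = length (snd s)"
        "length (fst s) + sum_list (map fst (fst s)) + sum_list (map fst (snd s)) = n"
      by (auto simp: gen_frobenius_partitions_def gen_frobenius_symbol_def symbol_size_def)
    have "fst s \<in> ?R" by (rule row) (use s in auto)
    moreover have "snd s \<in> ?R" by (rule row) (use s in auto)
    ultimately show "s \<in> ?R \<times> ?R"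
      by (simp add: mem_Times_iff)
  qed
  moreover have "finite (?R \<times> ?R)"
    by (intro finite_cartesian_product finite_lists_length_le) auto
  ultimately show ?thesis
    by (rule finite_subset)
qed

end

theory Submission
  imports Defs "HOL-Computational_Algebra.Formal_Laurent_Series" "HOL-Library.Product_Lexorder"
begin

unbundle fps_syntax

text \<open>
  A color class of a symbol is a finite set of integers carrying a charge and an energy, and a symbol
  is an 8-tuple of such sets of total charge 0. Translating a Maya diagram changes its charge
  and, in a controlled way, its energy; hence the generating function of pairs with given total charge is
  a sum over residues of theta series times generating functions of the components. Doubling three times
  from 1 to 8 colors gives \<open>p ^ 8\<close> times a polynomial in \<open>\<phi>(q)\<close>, \<open>\<psi>(q)\<close> and their dilations, where \<open>p\<close> is the
  generating function of the one-color sets of charge 0.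

  A sign-reversing involution gives \<open>p(q)\<^sup>2 \<phi>(-q) = p(q\<^sup>2)\<close>. As \<open>\<phi>(q) \<phi>(-q) = \<phi>(-q\<^sup>2)\<^sup>2\<close>, multiplying by a
  power of this even unit replaces \<open>p\<close> by \<open>p(q\<^sup>2)\<close> at the cost of a power of \<open>\<phi>(q)\<close>. The congruences then
  follow by 2-dissection, using \<open>\<phi>(q) = \<phi>(q\<^sup>4) + 2 q \<psi>(q\<^sup>8)\<close>,
  \<open>\<phi>(q)\<^sup>2 = \<phi>(q\<^sup>2)\<^sup>2 + 4 q \<psi>(q\<^sup>4)\<^sup>2\<close> and \<open>\<psi>(q)\<^sup>2 = \<phi>(q) \<psi>(q\<^sup>2)\<close>.
\<close>

section \<open>Weighted generating functions\<close>

definition fin_fibres :: "'a set \<Rightarrow> ('a \<Rightarrow> nat) \<Rightarrow> bool" where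
  "fin_fibres A w \<longleftrightarrow> (\<forall>n. finite {a \<in> A. w a = n})"

text \<open>The integer signs \<open>s\<close> let phi(-q) and the signed count of pairs share one
  definition with plain counting. A sum over an infinite fibre collapses to 0, so the splitting
  rules assume \<open>fin_fibres\<close>.\<close>

definition wgf :: "'a set \<Rightarrow> ('a \<Rightarrow> nat) \<Rightarrow> ('a \<Rightarrow> int) \<Rightarrow> int fps" where
  "wgf A w s = Abs_fps (\<lambda>n. \<Sum>a | a \<in> A \<and> w a = n. s a)"

lemma wgf_nth: "wgf A w s $ n = (\<Sum>a | a \<in> A \<and> w a = n. s a)"
  by (simp add: wgf_def)

lemma wgf_cong:
  assumes "A = B" "\<And>a. a \<in> B \<Longrightarrow> w a = w' a" "\<And>a. a \<in> B \<Longrightarrow> s a = s' a"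
  shows "wgf A w s = wgf B w' s'"
  using assms by (auto simp: fps_eq_iff wgf_nth intro!: sum.cong)

lemma wgf_bij:
  assumes "bij_betw h A B" "\<And>a. a \<in> A \<Longrightarrow> w' (h a) = w a + k" "\<And>a. a \<in> A \<Longrightarrow> s' (h a) = s a"
  shows "wgf B w' s' = fps_X ^ k * wgf A w s"
proof (rule fps_ext)
  fix n
  show "wgf B w' s' $ n = (fps_X ^ k * wgf A w s) $ n"
  proof (cases "n < k")
    case True
    have "{b. b \<in> B \<and> w' b = n} = {}"
      using assms(1,2) True by (fastforce simp: bij_betw_def)
    then show ?thesis
      using True by (simp only: wgf_nth fps_X_power_mult_nth) simp
  next
    case False
    have "bij_betw h {a. a \<in> A \<and> w a = n - k} {b. b \<in> B \<and> w' b = n}"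
      using assms(1,2) False by (fastforce simp: bij_betw_def inj_on_def)
    then show ?thesis
      using False assms(3) by (auto simp: wgf_nth fps_X_power_mult_nth sum.reindex_bij_betw[symmetric] intro!: sum.cong)
  qed
qed

lemma fin_fibres_subset: "fin_fibres B w \<Longrightarrow> A \<subseteq> B \<Longrightarrow> fin_fibres A w"
  unfolding fin_fibres_def
proof (intro allI)
  fix n
  assume *: "\<forall>n. finite {a \<in> B. w a = n}" "A \<subseteq> B"
  show "finite {a \<in> A. w a = n}"
    by (rule finite_subset[of _ "{a \<in> B. w a = n}"]) (use * in auto)
qed

lemma fin_fibres_times:
  assumes "fin_fibres A w" "fin_fibres B v"
  shows "fin_fibres (A \<times> B) (\<lambda>(a, b). w a + v b)"
  unfolding fin_fibres_def
proof
  fix n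
  have "{x \<in> A \<times> B. (case x of (a, b) \<Rightarrow> w a + v b) = n}
      \<subseteq> (\<Union>i\<in>{..n}. {a \<in> A. w a = i}) \<times> (\<Union>i\<in>{..n}. {b \<in> B. v b = i})"
    by auto
  moreover have "finite \<dots>"
    using assms by (intro finite_cartesian_product finite_UN_I) (auto simp: fin_fibres_def)
  ultimately show "finite {x \<in> A \<times> B. (case x of (a, b) \<Rightarrow> w a + v b) = n}"
    by (rule finite_subset)
qed

lemma wgf_times:
  assumes "fin_fibres A w" "fin_fibres B v"
  shows "wgf (A \<times> B) (\<lambda>(a, b). w a + v b) (\<lambda>(a, b). s a * t b) = wgf A w s * wgf B v t"
proof (rule fps_ext)
  fix n
  let ?A = "\<lambda>i. {a. a \<in> A \<and> w a = i}" and ?B = "\<lambda>i. {b. b \<in> B \<and> v b = i}"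
  have fin: "finite (?A i)" "finite (?B i)" for i
    using assms by (auto simp: fin_fibres_def)
  have "{x. x \<in> A \<times> B \<and> (case x of (a, b) \<Rightarrow> w a + v b) = n} = (\<Union>i\<in>{0..n}. ?A i \<times> ?B (n - i))"
    by auto
  then have "wgf (A \<times> B) (\<lambda>(a, b). w a + v b) (\<lambda>(a, b). s a * t b) $ n
      = (\<Sum>x\<in>(\<Union>i\<in>{0..n}. ?A i \<times> ?B (n - i)). case x of (a, b) \<Rightarrow> s a * t b)"
    by (simp only: wgf_nth)
  also have "\<dots> = (\<Sum>i=0..n. \<Sum>x\<in>?A i \<times> ?B (n - i). case x of (a, b) \<Rightarrow> s a * t b)"
    using fin by (intro sum.UNION_disjoint) auto
  also have "\<dots> = (\<Sum>i=0..n. (\<Sum>a\<in>?A i. s a) * (\<Sum>b\<in>?B (n - i). t b))"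
    by (simp only: sum_product sum.cartesian_product)
  finally show "wgf (A \<times> B) (\<lambda>(a, b). w a + v b) (\<lambda>(a, b). s a * t b) $ n = (wgf A w s * wgf B v t) $ n"
    by (simp add: fps_mult_nth wgf_nth)
qed

lemma wgf_Un:
  assumes "fin_fibres A w" "fin_fibres B w" "A \<inter> B = {}"
  shows "wgf (A \<union> B) w s = wgf A w s + wgf B w s"
proof (rule fps_ext)
  fix n
  have "{a. a \<in> A \<union> B \<and> w a = n} = {a \<in> A. w a = n} \<union> {a \<in> B. w a = n}"
    by auto
  then show "wgf (A \<union> B) w s $ n = (wgf A w s + wgf B w s) $ n"
    using assms by (auto simp: wgf_nth fin_fibres_def intro!: sum.union_disjoint)
qed

lemma wgf_UN:
  assumes "finite R" "\<And>r. r \<in> R \<Longrightarrow> fin_fibres (A r) w"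
    and "\<And>r r'. r \<in> R \<Longrightarrow> r' \<in> R \<Longrightarrow> r \<noteq> r' \<Longrightarrow> A r \<inter> A r' = {}"
  shows "wgf (\<Union>r\<in>R. A r) w s = (\<Sum>r\<in>R. wgf (A r) w s)"
proof (rule fps_ext)
  fix n
  have "{a. a \<in> (\<Union>r\<in>R. A r) \<and> w a = n} = (\<Union>r\<in>R. {a \<in> A r. w a = n})"
    by auto
  then have "wgf (\<Union>r\<in>R. A r) w s $ n = (\<Sum>a\<in>(\<Union>r\<in>R. {a \<in> A r. w a = n}). s a)"
    by (simp only: wgf_nth)
  also have "\<dots> = (\<Sum>r\<in>R. \<Sum>a\<in>{a \<in> A r. w a = n}. s a)"
    using assms(1,2) by (intro sum.UNION_disjoint) (auto simp: fin_fibres_def dest: assms(3))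
  finally show "wgf (\<Union>r\<in>R. A r) w s $ n = (\<Sum>r\<in>R. wgf (A r) w s) $ n"
    by (simp add: fps_sum_nth wgf_nth)
qed

section \<open>Dilation q -> q^2 and 2-dissection of power series\<close>

definition dil :: "int fps \<Rightarrow> int fps" where
  "dil f = f oo fps_X ^ 2"

lemma dil_nth: "dil f $ n = (if even n then f $ (n div 2) else 0)"
  by (simp add: dil_def fps_nth_compose_X_power)

lemma dil_add: "dil (f + g) = dil f + dil g"
  by (simp add: dil_def fps_compose_add_distrib)

lemma dil_diff: "dil (f - g) = dil f - dil g"
  by (simp add: dil_def fps_compose_sub_distrib)

lemma dil_mult: "dil (f * g) = dil f * dil g"
  by (simp add: dil_def fps_compose_mult_distrib)

lemma dil_1: "dil 1 = 1"
  by (simp add: dil_def)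

lemma dil_power: "dil (f ^ k) = dil f ^ k"
  by (induction k) (simp_all add: dil_mult dil_1)

lemma dil_numeral: "dil (numeral k) = numeral k"
  by (simp add: dil_def fps_numeral_fps_const)

lemma dil_X: "dil fps_X = fps_X ^ 2"
  by (simp add: dil_def)

lemmas dil_simps = dil_add dil_diff dil_mult dil_power dil_numeral dil_1 dil_X

lemma wgf_dil: "wgf A (\<lambda>a. 2 * w a) s = dil (wgf A w s)"
proof (rule fps_ext)
  fix n
  show "wgf A (\<lambda>a. 2 * w a) s $ n = dil (wgf A w s) $ n"
  proof (cases "even n")
    case True
    then show ?thesis
      by (auto simp: dil_nth wgf_nth elim!: evenE intro!: sum.cong)
  next
    case False
    then have "{a. a \<in> A \<and> 2 * w a = n} = {}" by auto
    then show ?thesis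
      using False by (simp add: dil_nth wgf_nth del: Collect_empty_eq)
  qed
qed

definition even_part :: "int fps \<Rightarrow> int fps" where
  "even_part f = Abs_fps (\<lambda>n. f $ (2 * n))"

definition odd_part :: "int fps \<Rightarrow> int fps" where
  "odd_part f = Abs_fps (\<lambda>n. f $ (2 * n + 1))"

lemma even_odd_parts: "f = dil (even_part f) + fps_X * dil (odd_part f)"
  by (rule fps_ext) (auto simp: dil_nth even_part_def odd_part_def elim!: evenE oddE)

lemma even_part_dil: "even_part (dil f + fps_X * dil g) = f"
  by (rule fps_ext) (auto simp: dil_nth even_part_def)

lemma odd_part_dil: "odd_part (dil f + fps_X * dil g) = g"
  by (rule fps_ext) (auto simp: dil_nth odd_part_def)

text \<open>Taking even or odd parts is linear over even series, so an even factor passes through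
  with its dilation undone. This lets dilated units be carried along in a dissection.\<close>

lemma even_part_dil_mult: "even_part (dil g * f) = g * even_part f"
proof -
  have "dil g * f = dil (g * even_part f) + fps_X * dil (g * odd_part f)"
    by (subst even_odd_parts[of f]) (simp add: dil_simps algebra_simps)
  then show ?thesis by (simp only: even_part_dil)
qed

lemma odd_part_dil_mult: "odd_part (dil g * f) = g * odd_part f"
proof -
  have "dil g * f = dil (g * even_part f) + fps_X * dil (g * odd_part f)"
    by (subst even_odd_parts[of f]) (simp add: dil_simps algebra_simps)
  then show ?thesis by (simp only: odd_part_dil)
qed

lemma even_part_add: "even_part (f + g) = even_part f + even_part g" and odd_part_add: "odd_part (f + g) = odd_part f + odd_part g"
  by (auto simp: fps_eq_iff even_part_def odd_part_def)

lemma numeral_dvd_fps_iff: "numeral k dvd (f :: int fps) \<longleftrightarrow> (\<forall>n. numeral k dvd f $ n)"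
proof
  assume "numeral k dvd f"
  then show "\<forall>n. numeral k dvd f $ n"
    by (auto simp: dvd_def fps_numeral_fps_const)
next
  assume "\<forall>n. numeral k dvd f $ n"
  then have "f = numeral k * Abs_fps (\<lambda>n. f $ n div numeral k)"
    by (intro fps_ext) (simp add: fps_numeral_fps_const)
  then show "numeral k dvd f" by (metis dvd_triv_left)
qed

section \<open>Theta series\<close>

text \<open>The truncation by \<open>nat\<close> is harmless for \<open>0 < n\<close> and
  \<open>\<bar>l\<bar> \<le> n\<close>, where the exponents are nonnegative.\<close>

definition theta :: "int \<Rightarrow> int \<Rightarrow> (int \<Rightarrow> int) \<Rightarrow> int fps" where
  "theta n l f = wgf UNIV (\<lambda>j. nat (n * j\<^sup>2 + l * j)) f"

abbreviation th :: "int \<Rightarrow> int \<Rightarrow> int fps" where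
  "th n l \<equiv> theta n l (\<lambda>_. 1)"

text \<open>Since |l j| \<le> n |j|, the form is at least n |j| (|j| - 1). The first bound makes the
  fibres of a theta series finite, the second makes the cast to \<open>nat\<close> faithful.\<close>

lemma quadratic_lower_bound:
  fixes n l j :: int
  assumes "0 < n" "\<bar>l\<bar> \<le> n"
  shows "\<bar>j\<bar> - 1 \<le> n * j\<^sup>2 + l * j" "0 \<le> n * j\<^sup>2 + l * j"
proof -
  have "\<bar>l * j\<bar> \<le> n * \<bar>j\<bar>"
    using assms by (simp add: abs_mult mult_right_mono)
  then have 1: "n * (\<bar>j\<bar> * (\<bar>j\<bar> - 1)) \<le> n * j\<^sup>2 + l * j"
    by (simp add: algebra_simps power2_eq_square)
  have 2: "\<bar>j\<bar> - 1 \<le> \<bar>j\<bar> * (\<bar>j\<bar> - 1)" "0 \<le> \<bar>j\<bar> * (\<bar>j\<bar> - 1)"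
    by (cases "j = 0"; simp add: mult_le_cancel_right1)+
  then have "\<bar>j\<bar> * (\<bar>j\<bar> - 1) \<le> n * (\<bar>j\<bar> * (\<bar>j\<bar> - 1))"
    using assms by (simp add: mult_le_cancel_right1)
  with 1 2 show "\<bar>j\<bar> - 1 \<le> n * j\<^sup>2 + l * j" "0 \<le> n * j\<^sup>2 + l * j"
    by linarith+
qed

lemma fin_fibres_quadratic:
  fixes n l :: int
  assumes "0 < n" "\<bar>l\<bar> \<le> n"
  shows "fin_fibres UNIV (\<lambda>j. nat (n * j\<^sup>2 + l * j))"
  unfolding fin_fibres_def
proof
  fix m
  have "{j \<in> UNIV. nat (n * j\<^sup>2 + l * j) = m} \<subseteq> {- int m - 1 .. int m + 1}"
  proof
    fix j assume "j \<in> {j \<in> UNIV. nat (n * j\<^sup>2 + l * j) = m}"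
    then have "n * j\<^sup>2 + l * j = int m"
      using quadratic_lower_bound(2)[OF assms, of j] by auto
    then have "\<bar>j\<bar> - 1 \<le> int m"
      using quadratic_lower_bound(1)[OF assms, of j] by simp
    then show "j \<in> {- int m - 1 .. int m + 1}" by auto
  qed
  then show "finite {j \<in> UNIV. nat (n * j\<^sup>2 + l * j) = m}"
    by (rule finite_subset) simp
qed

lemma theta_minus: "th n (- l) = th n l"
proof -
  have "bij_betw uminus (UNIV :: int set) UNIV"
    by (rule bij_betw_byWitness[of _ uminus]) auto
  from wgf_bij[OF this, of "\<lambda>j. nat (n * j\<^sup>2 + (- l) * j)" "\<lambda>j. nat (n * j\<^sup>2 + l * j)" 0 "\<lambda>_. 1" "\<lambda>_. 1"]
  show ?thesis by (simp add: theta_def)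
qed

lemma theta_dil: "theta (2 * n) (2 * l) f = dil (theta n l f)"
proof -
  have "nat (2 * n * j\<^sup>2 + 2 * l * j) = 2 * nat (n * j\<^sup>2 + l * j)" for j
    by (simp add: nat_mult_distrib[symmetric] algebra_simps del: nat_mult_distrib)
  then show ?thesis
    by (simp add: theta_def wgf_dil[symmetric])
qed

lemma wgf_uminus: "wgf A w (\<lambda>a. - s a) = - wgf A w s"
  by (rule fps_ext) (simp add: wgf_nth sum_negf)

text \<open>The odd integers are written -1 - 2 i rather than 2 i + 1 so that j^2 + j becomes the
  same polynomial in i on both classes.\<close>

lemma wgf_int_parity:
  fixes w :: "int \<Rightarrow> nat"
  assumes "fin_fibres UNIV w"
  shows "wgf UNIV w s = wgf UNIV (\<lambda>i. w (2 * i)) (\<lambda>i. s (2 * i))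
                      + wgf UNIV (\<lambda>i. w (- 1 - 2 * i)) (\<lambda>i. s (- 1 - 2 * i))"
proof -
  have "bij_betw (\<lambda>i::int. 2 * i) UNIV {j. even j}"
    by (rule bij_betw_byWitness[of _ "\<lambda>j. j div 2"]) auto
  from wgf_bij[OF this, of w "\<lambda>i. w (2 * i)" 0 s "\<lambda>i. s (2 * i)"]
  have e: "wgf {j. even j} w s = wgf UNIV (\<lambda>i. w (2 * i)) (\<lambda>i. s (2 * i))"
    by simp
  have "bij_betw (\<lambda>i::int. - 1 - 2 * i) UNIV {j. odd j}"
    by (rule bij_betw_byWitness[of _ "\<lambda>j. (- 1 - j) div 2"]) (auto elim!: oddE)
  from wgf_bij[OF this, of w "\<lambda>i. w (- 1 - 2 * i)" 0 s "\<lambda>i. s (- 1 - 2 * i)"]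
  have o: "wgf {j. odd j} w s = wgf UNIV (\<lambda>i. w (- 1 - 2 * i)) (\<lambda>i. s (- 1 - 2 * i))"
    by simp
  have "UNIV = {j::int. even j} \<union> {j. odd j}" by auto
  then have "wgf UNIV w s = wgf ({j. even j} \<union> {j. odd j}) w s" by simp
  also have "\<dots> = wgf {j. even j} w s + wgf {j. odd j} w s"
    by (rule wgf_Un) (auto intro: fin_fibres_subset[OF assms])
  finally show ?thesis by (simp only: e o)
qed

text \<open>The signs in the parametrization of the odd coset are chosen so that, for 0 \<le> l
  \<le> n, the linear coefficients it produces from n j^2 + l j are again nonnegative.\<close>

lemma wgf_int2_parity:
  fixes w :: "int \<times> int \<Rightarrow> nat"
  assumes "fin_fibres UNIV w"
  shows "wgf UNIV w (\<lambda>_. 1) = wgf UNIV (\<lambda>(x, y). w (x + y, x - y)) (\<lambda>_. 1)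
                      + wgf UNIV (\<lambda>(x, y). w (y - x, - 1 - x - y)) (\<lambda>_. 1)"
proof -
  have "bij_betw (\<lambda>(x, y). (x + y, x - y)) UNIV {(a::int, b). even (a + b)}"
  proof (rule bij_betw_imageI)
    show "inj_on (\<lambda>(x, y). (x + y, x - y)) (UNIV :: (int \<times> int) set)"
      by (auto simp: inj_on_def)
    show "(\<lambda>(x, y). (x + y, x - y)) ` UNIV = {(a::int, b). even (a + b)}"
    proof (intro equalityI subsetI)
      fix p assume "p \<in> {(a::int, b). even (a + b)}"
      then obtain a b k where p: "p = (a, b)" "a + b = 2 * k"
        by (cases p) (auto simp del: even_add elim: evenE)
      \<comment> \<open>The preimage solves x + y = a and x - y = b, using b = 2 k - a.\<close>
      then have "p = (\<lambda>(x, y). (x + y, x - y)) (k, a - k)" by simp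
      then show "p \<in> (\<lambda>(x, y). (x + y, x - y)) ` UNIV" by blast
    qed auto
  qed
  from wgf_bij[OF this, of w "\<lambda>(x, y). w (x + y, x - y)" 0 "\<lambda>_. 1" "\<lambda>_. 1"]
  have e: "wgf {(a, b). even (a + b)} w (\<lambda>_. 1) = wgf UNIV (\<lambda>(x, y). w (x + y, x - y)) (\<lambda>_. 1)"
    by (simp add: split_def)
  have "bij_betw (\<lambda>(x, y). (y - x, - 1 - x - y)) UNIV {(a::int, b). odd (a + b)}"
  proof (rule bij_betw_imageI)
    show "inj_on (\<lambda>(x, y). (y - x, - 1 - x - y)) (UNIV :: (int \<times> int) set)"
      by (auto simp: inj_on_def)
    show "(\<lambda>(x, y). (y - x, - 1 - x - y)) ` UNIV = {(a::int, b). odd (a + b)}"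
    proof (intro equalityI subsetI)
      fix p assume "p \<in> {(a::int, b). odd (a + b)}"
      then obtain a b k where p: "p = (a, b)" "a + b = 2 * k + 1"
        by (cases p) (auto simp del: even_add odd_add elim: oddE)
      then have "p = (\<lambda>(x, y). (y - x, - 1 - x - y)) (- k - 1, a - k - 1)" by simp
      then show "p \<in> (\<lambda>(x, y). (y - x, - 1 - x - y)) ` UNIV" by blast
    qed auto
  qed
  from wgf_bij[OF this, of w "\<lambda>(x, y). w (y - x, - 1 - x - y)" 0 "\<lambda>_. 1" "\<lambda>_. 1"]
  have o: "wgf {(a, b). odd (a + b)} w (\<lambda>_. 1) = wgf UNIV (\<lambda>(x, y). w (y - x, - 1 - x - y)) (\<lambda>_. 1)"
    by (simp add: split_def)
  have "UNIV = {(a::int, b). even (a + b)} \<union> {(a, b). odd (a + b)}" by auto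
  then have "wgf UNIV w (\<lambda>_. 1) = wgf ({(a, b). even (a + b)} \<union> {(a, b). odd (a + b)}) w (\<lambda>_. 1)" by simp
  also have "\<dots> = wgf {(a, b). even (a + b)} w (\<lambda>_. 1) + wgf {(a, b). odd (a + b)} w (\<lambda>_. 1)"
    by (rule wgf_Un) (auto intro: fin_fibres_subset[OF assms])
  finally show ?thesis by (simp only: e o)
qed

lemma theta_mult:
  assumes "0 < n" "\<bar>l\<bar> \<le> n" "0 < m" "\<bar>k\<bar> \<le> m"
  shows "th n l * th m k = wgf UNIV (\<lambda>(a, b). nat (n * a\<^sup>2 + l * a) + nat (m * b\<^sup>2 + k * b)) (\<lambda>_. 1)"
  unfolding theta_def
  using wgf_times[OF fin_fibres_quadratic[OF assms(1,2)] fin_fibres_quadratic[OF assms(3,4)], of "\<lambda>_. 1" "\<lambda>_. 1"]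
  by (simp add: case_prod_unfold)

text \<open>The sublattice of pairs with even sum and its coset are both rotated by 45 degrees.\<close>

lemma theta_square:
  assumes "0 < n" "0 \<le> l" "l \<le> n"
  shows "th n l ^ 2 = th (2 * n) (2 * l) * th (2 * n) 0
      + fps_X ^ nat (n - l) * (th (2 * n) (2 * n - 2 * l) * th (2 * n) (2 * n))"
proof -
  let ?q = "\<lambda>n l j :: int. n * j\<^sup>2 + l * j"
  let ?w = "\<lambda>(a, b). nat (?q n l a) + nat (?q n l b)"
  have fin: "fin_fibres UNIV ?w"
    using fin_fibres_times[OF fin_fibres_quadratic[of n l] fin_fibres_quadratic[of n l]] assms by simp
  have nn: "0 \<le> ?q n l j" "0 \<le> ?q (2 * n) (2 * l) j" "0 \<le> ?q (2 * n) 0 j"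
     "0 \<le> ?q (2 * n) (2 * n - 2 * l) j" "0 \<le> ?q (2 * n) (2 * n) j" for j
    using assms by (intro quadratic_lower_bound(2); simp)+
  have 1: "?w (x + y, x - y) = nat (?q (2 * n) (2 * l) x) + nat (?q (2 * n) 0 y)" for x y
    using nn[of x] nn[of y] nn(1)[of "x + y"] nn(1)[of "x - y"]
    by (simp add: nat_add_distrib[symmetric]) (simp add: power2_eq_square algebra_simps)
  have 2: "?w (y - x, - 1 - x - y)
      = nat (?q (2 * n) (2 * n - 2 * l) x) + nat (?q (2 * n) (2 * n) y) + nat (n - l)" for x y
    using nn[of x] nn[of y] nn(1)[of "y - x"] nn(1)[of "- 1 - x - y"] assms
    by (simp add: nat_add_distrib[symmetric]) (simp add: power2_eq_square algebra_simps)
  have "th n l ^ 2 = wgf UNIV ?w (\<lambda>_. 1)"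
    using assms by (simp add: power2_eq_square theta_mult)
  also have "\<dots> = wgf UNIV (\<lambda>(x, y). ?w (x + y, x - y)) (\<lambda>_. 1)
                + wgf UNIV (\<lambda>(x, y). ?w (y - x, - 1 - x - y)) (\<lambda>_. 1)"
    by (rule wgf_int2_parity[OF fin])
  also have "wgf UNIV (\<lambda>(x, y). ?w (x + y, x - y)) (\<lambda>_. 1) = th (2 * n) (2 * l) * th (2 * n) 0"
    using assms by (subst theta_mult) (simp_all, use 1 in simp)
  also have "wgf UNIV (\<lambda>(x, y). ?w (y - x, - 1 - x - y)) (\<lambda>_. 1)
      = fps_X ^ nat (n - l) * (th (2 * n) (2 * n - 2 * l) * th (2 * n) (2 * n))"
  proof -
    have "wgf UNIV (\<lambda>(x, y). ?w (y - x, - 1 - x - y)) (\<lambda>_. 1)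
       = fps_X ^ nat (n - l) * wgf UNIV (\<lambda>(a, b). nat (?q (2 * n) (2 * n - 2 * l) a) + nat (?q (2 * n) (2 * n) b)) (\<lambda>_. 1)"
      by (rule wgf_bij[of id]) (use 2 in \<open>auto split: prod.split\<close>)
    then show ?thesis
      using assms by (subst theta_mult) simp_all
  qed
  finally show ?thesis .
qed

text \<open>\<open>phi\<close> is \<open>\<phi>(q)\<close>, \<open>psi\<close> is \<open>\<psi>(q)\<close> (the exponents \<open>2 j\<^sup>2 + j\<close> run once through the triangular
  numbers), and \<open>phim\<close> is \<open>\<phi>(-q)\<close>.\<close>

definition phi :: "int fps" where "phi = th 1 0"
definition psi :: "int fps" where "psi = th 2 1"

abbreviation sgn_parity :: "int \<Rightarrow> int" where
  "sgn_parity j \<equiv> (if even j then 1 else - 1)"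

definition phim :: "int fps" where "phim = theta 1 0 sgn_parity"

text \<open>Each value of j^2 + j is attained at both j and -1 - j, which have opposite parity; the
  parity split therefore yields two equal halves.\<close>

lemma theta_1_1: "th 1 1 = 2 * dil psi"
proof -
  have 1: "(2 * i)\<^sup>2 + 2 * i = 4 * i\<^sup>2 + 2 * i" "(- 1 - 2 * i)\<^sup>2 + (- 1 - 2 * i) = 4 * i\<^sup>2 + 2 * i" for i :: int
    by (simp_all add: power2_eq_square algebra_simps)
  have "th 1 1 = wgf UNIV (\<lambda>j. nat (j\<^sup>2 + j)) (\<lambda>_. 1)"
    by (simp add: theta_def)
  also have "\<dots> = th 4 2 + th 4 2"
    using fin_fibres_quadratic[of 1 1]
    by (subst wgf_int_parity) (simp_all only: 1 theta_def, simp_all)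
  also have "th 4 2 = dil psi"
    using theta_dil[of 2 1] by (simp add: psi_def)
  finally show ?thesis by simp
qed

text \<open>The sign is constant on each parity class, so the two series differ only in the sign of
  the half coming from odd j.\<close>

lemma phi_parity: "phi = th 4 0 + fps_X * th 4 4" and phim_parity: "phim = th 4 0 - fps_X * th 4 4"
proof -
  have 1: "nat ((2 * i)\<^sup>2) = nat (4 * i\<^sup>2)" for i :: int
    by (simp add: power2_eq_square algebra_simps)
  have 2: "nat ((- 1 - 2 * i)\<^sup>2) = nat (4 * i\<^sup>2 + 4 * i) + 1" for i :: int
    using quadratic_lower_bound(2)[of 4 4 i] by (simp add: power2_eq_square algebra_simps nat_add_distrib[symmetric])
  have 3: "wgf UNIV (\<lambda>i. nat (4 * i\<^sup>2 + 4 * i) + 1) (\<lambda>_. 1) = fps_X * th 4 4"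
    using wgf_bij[of id UNIV UNIV "\<lambda>i. nat (4 * i\<^sup>2 + 4 * i) + 1" "\<lambda>i. nat (4 * i\<^sup>2 + 4 * i)" 1 "\<lambda>_. 1" "\<lambda>_. 1"]
    by (simp add: theta_def)
  have fin: "fin_fibres UNIV (\<lambda>j::int. nat (j\<^sup>2))"
    using fin_fibres_quadratic[of 1 0] by simp
  have "phi = wgf UNIV (\<lambda>j. nat (j\<^sup>2)) (\<lambda>_. 1)"
    by (simp add: phi_def theta_def)
  also have "\<dots> = th 4 0 + fps_X * th 4 4"
    by (subst wgf_int_parity[OF fin]) (simp only: 1 2 3, simp add: theta_def)
  finally show "phi = th 4 0 + fps_X * th 4 4" .
  have "phim = wgf UNIV (\<lambda>j. nat (j\<^sup>2)) sgn_parity"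
    by (simp add: phim_def theta_def)
  also have "\<dots> = wgf UNIV (\<lambda>i. nat (4 * i\<^sup>2)) (\<lambda>_. 1) + wgf UNIV (\<lambda>i. nat (4 * i\<^sup>2 + 4 * i) + 1) (\<lambda>_. - 1)"
    by (subst wgf_int_parity[OF fin]) (simp only: 1 2, simp)
  also have "\<dots> = th 4 0 - fps_X * th 4 4"
    by (simp only: wgf_uminus 3) (simp add: theta_def)
  finally show "phim = th 4 0 - fps_X * th 4 4" .
qed

lemma theta_dilations:
  "th 2 0 = dil phi" "th 4 0 = dil (dil phi)"
  "th 2 2 = 2 * dil (dil psi)" "th 4 4 = 2 * dil (dil (dil psi))" "th 4 2 = dil psi"
  using theta_dil[of 1 0 "\<lambda>_. 1"] theta_dil[of 2 0 "\<lambda>_. 1"] theta_dil[of 1 1 "\<lambda>_. 1"]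
    theta_dil[of 2 2 "\<lambda>_. 1"] theta_dil[of 2 1 "\<lambda>_. 1"]
  by (simp_all add: phi_def psi_def[symmetric] theta_1_1 dil_simps)

lemma phi_dissection: "phi = dil (dil phi) + 2 * fps_X * dil (dil (dil psi))"
  using phi_parity by (simp add: theta_dilations mult_ac)

lemma phim_dissection: "phim = dil (dil phi) - 2 * fps_X * dil (dil (dil psi))"
  using phim_parity by (simp add: theta_dilations mult_ac)

lemma phi_square: "phi ^ 2 = dil phi ^ 2 + 4 * fps_X * dil (dil psi) ^ 2"
  using theta_square[of 1 0] by (simp add: theta_dilations phi_def[symmetric] power2_eq_square)

text \<open>In \<open>theta_square\<close> with n = 2 and l = 1 both summands contain
  \<open>th 4 2\<close>, and the cofactor is the dissection of \<open>phi\<close>.\<close>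

lemma psi_square: "psi ^ 2 = dil psi * phi"
  using theta_square[of 2 1] by (subst phi_dissection) (simp add: theta_dilations psi_def[symmetric] algebra_simps)

section \<open>Charged classes with translations\<close>

definition charged_gf :: "'a set \<Rightarrow> ('a \<Rightarrow> int) \<Rightarrow> ('a \<Rightarrow> nat) \<Rightarrow> int \<Rightarrow> int fps" where
  "charged_gf A ch wt s = wgf {a \<in> A. ch a = s} wt (\<lambda>_. 1)"

text \<open>Here \<open>n\<close> is the number of colors translated together. The energy law is
  stated doubled to avoid halving j (j + 1). The axioms survive products, so one pairing argument
  serves every doubling of the number of colors.\<close>

locale shift_class =
  fixes A :: "'a set" and ch :: "'a \<Rightarrow> int" and wt :: "'a \<Rightarrow> nat"
    and sh :: "int \<Rightarrow> 'a \<Rightarrow> 'a" and n :: int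
  assumes n_pos: "0 < n"
    and sh_closed: "a \<in> A \<Longrightarrow> sh j a \<in> A"
    and sh_inverse: "a \<in> A \<Longrightarrow> sh (- j) (sh j a) = a"
    and ch_sh: "a \<in> A \<Longrightarrow> ch (sh j a) = ch a + n * j"
    and wt_sh: "a \<in> A \<Longrightarrow> 2 * int (wt (sh j a)) = 2 * int (wt a) + 2 * j * ch a + n * (j * (j + 1))"
    and fin: "fin_fibres A wt"
begin

abbreviation U :: "int \<Rightarrow> int fps" where
  "U \<equiv> charged_gf A ch wt"

lemma sh_inverse_minus: "a \<in> A \<Longrightarrow> sh j (sh (- j) a) = a"
  using sh_inverse[of a "- j"] by simp

text \<open>Translating the components by j and -j keeps the total charge, and every pair in the
  residue class arises once from charges r and s - r. The terms linear in n j cancel, so the energy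
  grows by n j^2 + (2 r - s) j. The factor \<open>f\<close> leaves room for signs.\<close>

lemma pairing_residue:
  assumes "\<bar>2 * r - s\<bar> \<le> n"
  shows "wgf {(a, b) \<in> A \<times> A. ch a + ch b = s \<and> n dvd ch a - r} (\<lambda>(a, b). wt a + wt b) (\<lambda>(a, b). f (ch a))
    = theta n (2 * r - s) (\<lambda>j. f (r + n * j)) * (U r * U (s - r))"
proof -
  let ?A = "\<lambda>r. {a \<in> A. ch a = r}"
  let ?E = "{(a, b) \<in> A \<times> A. ch a + ch b = s \<and> n dvd ch a - r}"
  let ?q = "\<lambda>j. nat (n * j\<^sup>2 + (2 * r - s) * j)"
  let ?h = "\<lambda>(j, (a, b)). (sh j a, sh (- j) b)"
  let ?w = "\<lambda>(j, (a, b)). ?q j + (wt a + wt b)"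
  let ?s = "\<lambda>(j, _). f (r + n * j)"
  have bij: "bij_betw ?h (UNIV \<times> (?A r \<times> ?A (s - r))) ?E"
    \<comment> \<open>The amount of translation is recovered from the charge of the first
      component.\<close>
    by (rule bij_betw_byWitness[of _ "\<lambda>(a, b). ((ch a - r) div n, (sh (- ((ch a - r) div n)) a, sh ((ch a - r) div n) b))"])
       (use n_pos in \<open>auto simp: sh_inverse sh_inverse_minus ch_sh sh_closed algebra_simps\<close>)
  have wt: "wt (sh j a) + wt (sh (- j) b) = ?q j + (wt a + wt b)"
    if "a \<in> ?A r" "b \<in> ?A (s - r)" for j a b
  proof -
    have "2 * int (wt (sh j a) + wt (sh (- j) b)) = 2 * (n * j\<^sup>2 + (2 * r - s) * j + int (wt a + wt b))"
    proof -
      have "2 * int (wt (sh j a)) = 2 * int (wt a) + 2 * j * r + n * (j * (j + 1))"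
        using that wt_sh[of a j] by simp
      moreover have "2 * int (wt (sh (- j) b)) = 2 * int (wt b) + 2 * (- j) * (s - r) + n * (- j * (- j + 1))"
        using that wt_sh[of b "- j"] by simp
      ultimately show ?thesis by (simp add: algebra_simps power2_eq_square)
    qed
    moreover have "0 \<le> n * j\<^sup>2 + (2 * r - s) * j"
      by (rule quadratic_lower_bound(2)[OF n_pos assms])
    ultimately have "int (wt (sh j a) + wt (sh (- j) b)) = int (?q j + (wt a + wt b))" by simp
    then show ?thesis by (simp only: of_nat_eq_iff)
  qed
  have "wgf ?E (\<lambda>(a, b). wt a + wt b) (\<lambda>(a, b). f (ch a)) = fps_X ^ 0 * wgf (UNIV \<times> (?A r \<times> ?A (s - r))) ?w ?s"
  proof (rule wgf_bij[OF bij], goal_cases)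
    case (1 a)
    then show ?case using wt by (auto simp del: mem_Collect_eq)
  next
    case (2 a)
    then show ?case by (auto simp: ch_sh)
  qed
  also have "\<dots> = wgf (UNIV \<times> (?A r \<times> ?A (s - r))) (\<lambda>(j, x). ?q j + (case x of (a, b) \<Rightarrow> wt a + wt b))
                  (\<lambda>(j, x). f (r + n * j) * (case x of (a, b) \<Rightarrow> 1 * 1))"
    by (simp, intro wgf_cong) auto
  also have "\<dots> = wgf UNIV ?q (\<lambda>j. f (r + n * j))
      * wgf (?A r \<times> ?A (s - r)) (\<lambda>(a, b). wt a + wt b) (\<lambda>(a, b). 1 * 1)"
    by (intro wgf_times fin_fibres_times fin_fibres_quadratic n_pos assms)
       (auto intro: fin_fibres_subset[OF fin])
  also have "wgf (?A r \<times> ?A (s - r)) (\<lambda>(a, b). wt a + wt b) (\<lambda>(a, b). 1 * 1) = U r * U (s - r)"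
    unfolding charged_gf_def by (rule wgf_times) (auto intro: fin_fibres_subset[OF fin])
  finally show ?thesis
    by (simp add: theta_def)
qed

text \<open>The pairs are sorted by the residue of the first charge modulo n. The two hypotheses say
  exactly that both ends c and c + n - 1 of the window of representatives satisfy |2 r - s| \<le>
  n.\<close>

lemma pairing:
  assumes "s \<le> 2 * c + n" "2 * c + n \<le> s + 2"
  shows "wgf {(a, b) \<in> A \<times> A. ch a + ch b = s} (\<lambda>(a, b). wt a + wt b) (\<lambda>(a, b). f (ch a))
    = (\<Sum>r\<in>{c..<c + n}. theta n (2 * r - s) (\<lambda>j. f (r + n * j)) * (U r * U (s - r)))"
proof -
  let ?E = "\<lambda>r. {(a, b) \<in> A \<times> A. ch a + ch b = s \<and> n dvd ch a - r}"
  have ex: "\<exists>r\<in>{c..<c + n}. n dvd t - r" for t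
    by (rule bexI[of _ "c + (t - c) mod n"]) (use n_pos in \<open>auto simp: mod_eq_dvd_iff[symmetric] mod_simps\<close>)
  have uniq: "r = r'" if "r \<in> {c..<c + n}" "r' \<in> {c..<c + n}" "n dvd t - r" "n dvd t - r'" for r r' t
  proof -
    have "n dvd r - r'" using dvd_diff[OF that(4,3)] by simp
    moreover have "\<bar>r - r'\<bar> < n" using that(1,2) by auto
    ultimately show ?thesis using zdvd_not_zless[of "\<bar>r - r'\<bar>" n] by (cases "r = r'") auto
  qed
  have "{(a, b) \<in> A \<times> A. ch a + ch b = s} = (\<Union>r\<in>{c..<c + n}. ?E r)"
    using ex by fastforce
  then have "wgf {(a, b) \<in> A \<times> A. ch a + ch b = s} (\<lambda>(a, b). wt a + wt b) (\<lambda>(a, b). f (ch a))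
      = wgf (\<Union>r\<in>{c..<c + n}. ?E r) (\<lambda>(a, b). wt a + wt b) (\<lambda>(a, b). f (ch a))"
    by (simp only:)
  also have "\<dots> = (\<Sum>r\<in>{c..<c + n}. wgf (?E r) (\<lambda>(a, b). wt a + wt b) (\<lambda>(a, b). f (ch a)))"
  proof (rule wgf_UN)
    fix r
    show "fin_fibres (?E r) (\<lambda>(a, b). wt a + wt b)"
      by (rule fin_fibres_subset[OF fin_fibres_times[OF fin fin]]) auto
  next
    fix r r' assume "r \<in> {c..<c + n}" "r' \<in> {c..<c + n}" "r \<noteq> r'"
    then show "?E r \<inter> ?E r' = {}" using uniq by auto
  qed simp
  also have "\<dots> = (\<Sum>r\<in>{c..<c + n}. theta n (2 * r - s) (\<lambda>j. f (r + n * j)) * (U r * U (s - r)))"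
    by (rule sum.cong[OF refl], rule pairing_residue) (use assms in auto)
  finally show ?thesis .
qed

lemma shift_class_double:
  "shift_class (A \<times> A) (\<lambda>(a, b). ch a + ch b) (\<lambda>(a, b). wt a + wt b)
    (\<lambda>j (a, b). (sh j a, sh j b)) (2 * n)"
proof unfold_locales
  show "0 < 2 * n" using n_pos by simp
  show "fin_fibres (A \<times> A) (\<lambda>(a, b). wt a + wt b)" by (rule fin_fibres_times[OF fin fin])
  fix x j assume "x \<in> A \<times> A"
  then obtain a b where x: "x = (a, b)" "a \<in> A" "b \<in> A" by auto
  show "2 * int (case (case x of (a, b) \<Rightarrow> (sh j a, sh j b)) of (a, b) \<Rightarrow> wt a + wt b)
      = 2 * int (case x of (a, b) \<Rightarrow> wt a + wt b) + 2 * j * (case x of (a, b) \<Rightarrow> ch a + ch b) + 2 * n * (j * (j + 1))"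
    using x wt_sh[of a j] wt_sh[of b j] by (simp add: algebra_simps)
qed (auto simp: sh_closed sh_inverse ch_sh algebra_simps)

lemma charged_gf_double:
  assumes "s \<le> 2 * c + n" "2 * c + n \<le> s + 2"
  shows "charged_gf (A \<times> A) (\<lambda>(a, b). ch a + ch b) (\<lambda>(a, b). wt a + wt b) s
    = (\<Sum>r\<in>{c..<c + n}. th n (2 * r - s) * (U r * U (s - r)))"
  using pairing[OF assms, of "\<lambda>_. 1"]
  by (simp add: charged_gf_def case_prod_unfold mem_Times_iff)

end

section \<open>Finite sets of integers as Maya diagrams\<close>

text \<open>Positive elements are occupied positions above the vacuum, nonpositive ones are holes
  below it. The boundary case 0 is a hole, with charge -1 and energy 0.\<close>

definition charge1 :: "int \<Rightarrow> int" where
  "charge1 x = (if 0 < x then 1 else - 1)"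

definition charge :: "int set \<Rightarrow> int" where
  "charge X = (\<Sum>x\<in>X. charge1 x)"

definition energy :: "int set \<Rightarrow> nat" where
  "energy X = (\<Sum>x\<in>X. nat \<bar>x\<bar>)"

text \<open>A finite set \<open>X\<close> stands for the Maya diagram given by the symmetric difference of \<open>X\<close> and
  \<open>{..0}\<close>, which \<open>shift j\<close> translates by \<open>j\<close>.\<close>

definition shift :: "int \<Rightarrow> int set \<Rightarrow> int set" where
  "shift j X = {x. (x - j \<in> X) = ((x \<le> j) = (x \<le> 0))}"

abbreviation finsets :: "int set set" where
  "finsets \<equiv> {X. finite X}"

lemma shift_shift: "shift i (shift j X) = shift (i + j) X"
  by (auto simp: shift_def algebra_simps)

lemma shift_0: "shift 0 X = X"
  by (auto simp: shift_def)

text \<open>Only positions between 0 and j change their status relative to the vacuum.\<close>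

lemma finite_shift:
  assumes "finite X"
  shows "finite (shift j X)"
proof (rule finite_subset)
  show "shift j X \<subseteq> (\<lambda>x. x + j) ` X \<union> {- \<bar>j\<bar>..\<bar>j\<bar>}"
  proof
    fix x assume x: "x \<in> shift j X"
    show "x \<in> (\<lambda>x. x + j) ` X \<union> {- \<bar>j\<bar>..\<bar>j\<bar>}"
    proof (cases "x - j \<in> X")
      case True
      then have "x = (x - j) + j" "x - j \<in> X" by auto
      then show ?thesis by blast
    next
      case False
      then show ?thesis using x by (auto simp: shift_def)
    qed
  qed
qed (use assms in simp)

text \<open>Only position 0 crosses the vacuum level: a hole there disappears, whereas an occupied 0
  becomes the particle at 1.\<close>

lemma shift_1_eq: "shift 1 X = (\<lambda>x. x + 1) ` (X - {0}) \<union> (if 0 \<in> X then {} else {1})"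
proof (rule set_eqI)
  fix x
  have "x \<in> (\<lambda>x. x + 1) ` (X - {0}) \<longleftrightarrow> x - 1 \<in> X \<and> x \<noteq> 1"
    by (auto intro: image_eqI[of _ _ "x - 1"])
  then show "x \<in> shift 1 X \<longleftrightarrow> x \<in> (\<lambda>x. x + 1) ` (X - {0}) \<union> (if 0 \<in> X then {} else {1})"
    by (cases "x = 1") (auto simp: shift_def)
qed

text \<open>Away from 0, a particle gains one unit of energy and a hole loses one, so the energy
  changes by the charge. Whichever happens at position 0 supplies the extra 1.\<close>

lemma charge_energy_shift_1:
  assumes "finite X"
  shows "charge (shift 1 X) = charge X + 1" "int (energy (shift 1 X)) = int (energy X) + charge X + 1"
proof -
  let ?Y = "X - {0}" and ?f = "\<lambda>x::int. x + 1"
  have inj: "inj_on ?f ?Y" by (simp add: inj_on_def)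
  have ch: "charge (?f ` ?Y) = charge ?Y"
    unfolding charge_def by (subst sum.reindex[OF inj]) (auto simp: charge1_def intro!: sum.cong split: if_splits)
  have en: "int (energy (?f ` ?Y)) = int (energy ?Y) + charge ?Y"
    unfolding charge_def energy_def
    by (subst sum.reindex[OF inj]) (auto simp: charge1_def sum.distrib[symmetric] intro!: sum.cong split: if_splits)
  show "charge (shift 1 X) = charge X + 1" "int (energy (shift 1 X)) = int (energy X) + charge X + 1"
  proof (atomize(full), cases "0 \<in> X")
    case True
    then have "charge X = charge ?Y - 1" "energy X = energy ?Y"
      using assms by (simp_all add: charge_def energy_def sum.remove[of X 0] charge1_def)
    then show "charge (shift 1 X) = charge X + 1 \<and> int (energy (shift 1 X)) = int (energy X) + charge X + 1"
      using True ch en by (simp add: shift_1_eq)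
  next
    case False
    then have X: "?Y = X" by simp
    have "1 \<notin> ?f ` X" using False by auto
    then have "charge (insert 1 (?f ` X)) = charge (?f ` X) + 1"
        "energy (insert 1 (?f ` X)) = energy (?f ` X) + 1"
      using assms by (simp_all add: charge_def energy_def charge1_def)
    then show "charge (shift 1 X) = charge X + 1 \<and> int (energy (shift 1 X)) = int (energy X) + charge X + 1"
      using False ch en by (simp add: shift_1_eq X)
  qed
qed

text \<open>Iterating the unit step adds up an arithmetic progression of charges. For negative j the
  unit step is read backwards.\<close>

lemma charge_energy_shift:
  assumes "finite X"
  shows "charge (shift j X) = charge X + j \<and>
    2 * int (energy (shift j X)) = 2 * int (energy X) + 2 * j * charge X + j * (j + 1)"
proof (induction j rule: int_induct[where k = 0])
  case base
  then show ?case by (simp add: shift_0)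
next
  case (step1 i)
  have "shift (i + 1) X = shift 1 (shift i X)"
    by (simp add: shift_shift add.commute)
  then show ?case
    using step1 charge_energy_shift_1[OF finite_shift[OF assms, of i]] by (simp add: algebra_simps)
next
  case (step2 i)
  have "shift i X = shift 1 (shift (i - 1) X)"
    by (simp add: shift_shift)
  then show ?case
    using step2 charge_energy_shift_1[OF finite_shift[OF assms, of "i - 1"]] by (simp add: algebra_simps)
qed

lemma fin_fibres_energy: "fin_fibres finsets energy"
  unfolding fin_fibres_def
proof
  fix m
  have "{X \<in> finsets. energy X = m} \<subseteq> Pow {- int m..int m}"
  proof clarify
    fix X :: "int set" and x assume "finite X" "x \<in> X" "m = energy X"
    then have "nat \<bar>x\<bar> \<le> energy X" unfolding energy_def by (intro member_le_sum) auto
    then show "x \<in> {- int (energy X)..int (energy X)}" by auto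
  qed
  then show "finite {X \<in> finsets. energy X = m}"
    by (rule finite_subset) simp
qed

lemma shift_class_finsets: "shift_class finsets charge energy shift 1"
  by unfold_locales (auto simp: finite_shift charge_energy_shift shift_shift shift_0 fin_fibres_energy)

interpretation f1: shift_class finsets charge energy shift 1
  by (rule shift_class_finsets)

definition gf1 :: "int \<Rightarrow> int fps" where
  "gf1 = charged_gf finsets charge energy"

text \<open>Maya diagrams of charge 0 correspond to ordinary partitions through Frobenius
  coordinates, so this is the partition generating function.\<close>

definition p :: "int fps" where "p = gf1 0"

lemma gf1_eq: "gf1 s = fps_X ^ nat (s * (s + 1) div 2) * p"
  unfolding p_def gf1_def charged_gf_def
proof (rule wgf_bij)
  show "bij_betw (shift s) {X \<in> finsets. charge X = 0} {X \<in> finsets. charge X = s}"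
    by (rule bij_betw_byWitness[of _ "shift (- s)"])
       (auto simp: shift_shift shift_0 finite_shift charge_energy_shift)
next
  fix X assume "X \<in> {X \<in> finsets. charge X = 0}"
  then have "2 * int (energy (shift s X)) = 2 * int (energy X) + s * (s + 1)"
    by (simp add: charge_energy_shift)
  moreover have "0 \<le> s * (s + 1)"
    by (cases "0 \<le> s") (auto intro: mult_nonpos_nonpos)
  ultimately show "energy (shift s X) = energy X + nat (s * (s + 1) div 2)"
    by simp
qed simp

section \<open>From one color to eight by doubling\<close>

abbreviation "finsets2 \<equiv> finsets \<times> finsets"
abbreviation "charge2 \<equiv> \<lambda>(a, b). charge a + charge b"
abbreviation "energy2 \<equiv> \<lambda>(a, b). energy a + energy b"
abbreviation "finsets4 \<equiv> finsets2 \<times> finsets2"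
abbreviation "charge4 \<equiv> \<lambda>(a, b). charge2 a + charge2 b"
abbreviation "energy4 \<equiv> \<lambda>(a, b). energy2 a + energy2 b"

interpretation f2: shift_class finsets2 charge2 energy2 "\<lambda>j (a, b). (shift j a, shift j b)" 2
  using f1.shift_class_double by simp

interpretation f4: shift_class finsets4 charge4 energy4
    "\<lambda>j (x, y). ((case x of (a, b) \<Rightarrow> (shift j a, shift j b)), (case y of (a, b) \<Rightarrow> (shift j a, shift j b)))" 4
  using f2.shift_class_double by simp

definition gf2 :: "int \<Rightarrow> int fps" where
  "gf2 = charged_gf finsets2 charge2 energy2"

definition gf4 :: "int \<Rightarrow> int fps" where
  "gf4 = charged_gf finsets4 charge4 energy4"

definition gf8 :: "int \<Rightarrow> int fps" where
  "gf8 = charged_gf (finsets4 \<times> finsets4) (\<lambda>(a, b). charge4 a + charge4 b) (\<lambda>(a, b). energy4 a + energy4 b)"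

lemma gf2_rec:
  assumes "s \<le> 2 * c + 1" "2 * c + 1 \<le> s + 2"
  shows "gf2 s = (\<Sum>r\<in>{c..<c + 1}. th 1 (2 * r - s) * (gf1 r * gf1 (s - r)))"
  unfolding gf1_def gf2_def by (rule f1.charged_gf_double[OF assms])

lemma gf4_rec:
  assumes "s \<le> 2 * c + 2" "2 * c + 2 \<le> s + 2"
  shows "gf4 s = (\<Sum>r\<in>{c..<c + 2}. th 2 (2 * r - s) * (gf2 r * gf2 (s - r)))"
  unfolding gf2_def gf4_def by (rule f2.charged_gf_double[OF assms])

lemma gf8_rec:
  assumes "s \<le> 2 * c + 4" "2 * c + 4 \<le> s + 2"
  shows "gf8 s = (\<Sum>r\<in>{c..<c + 4}. th 4 (2 * r - s) * (gf4 r * gf4 (s - r)))"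
  unfolding gf4_def gf8_def by (rule f4.charged_gf_double[OF assms])

text \<open>Charges from -2 to 2 are the ones that the windows of the next two doublings
  reach.\<close>

lemma gf2_eq:
  "gf2 0 = phi * p\<^sup>2" "gf2 1 = 2 * fps_X * dil psi * p\<^sup>2" "gf2 (- 1) = 2 * dil psi * p\<^sup>2"
  "gf2 2 = fps_X\<^sup>2 * phi * p\<^sup>2" "gf2 (- 2) = phi * p\<^sup>2"
proof -
  have "{0..<1::int} = {0}" "{1..<2::int} = {1}" "{-1..<0::int} = {-1}" by auto
  note simps = this gf1_eq theta_1_1 phi_def[symmetric] power2_eq_square theta_minus[of 1 1]
  show "gf2 0 = phi * p\<^sup>2"
    using gf2_rec[of 0 0] by (simp add: simps)
  show "gf2 1 = 2 * fps_X * dil psi * p\<^sup>2"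
    using gf2_rec[of 1 0] by (simp add: simps algebra_simps)
  show "gf2 (- 1) = 2 * dil psi * p\<^sup>2"
    using gf2_rec[of "- 1" "- 1"] by (simp add: simps algebra_simps)
  show "gf2 2 = fps_X\<^sup>2 * phi * p\<^sup>2"
    using gf2_rec[of 2 1] by (simp add: simps algebra_simps)
  show "gf2 (- 2) = phi * p\<^sup>2"
    using gf2_rec[of "- 2" "- 1"] by (simp add: simps algebra_simps)
qed

lemma gf4_eq:
  "gf4 0 = (dil phi * phi\<^sup>2 + 8 * fps_X * dil (dil psi) * dil psi ^ 2) * p ^ 4"
  "gf4 1 = 4 * fps_X * psi * phi * dil psi * p ^ 4"
  "gf4 (- 1) = 4 * psi * phi * dil psi * p ^ 4"
  "gf4 2 = fps_X\<^sup>2 * (2 * dil (dil psi) * phi\<^sup>2 + 4 * dil phi * dil psi ^ 2) * p ^ 4"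
  "gf4 (- 2) = (2 * dil (dil psi) * phi\<^sup>2 + 4 * dil phi * dil psi ^ 2) * p ^ 4"
proof -
  have 4: "p ^ 4 = p\<^sup>2 * p\<^sup>2" by (simp add: power_add[symmetric])
  have "{0..<2::int} = {0, 1}" "{-1..<1::int} = {-1, 0}" by auto
  note simps = this gf2_eq theta_dilations psi_def[symmetric] theta_minus[of 2 1] theta_minus[of 2 2]
  show "gf4 0 = (dil phi * phi\<^sup>2 + 8 * fps_X * dil (dil psi) * dil psi ^ 2) * p ^ 4"
    using gf4_rec[of 0 0] by (simp add: simps) (simp add: 4 algebra_simps power2_eq_square)
  show "gf4 1 = 4 * fps_X * psi * phi * dil psi * p ^ 4"
    using gf4_rec[of 1 0] by (simp add: simps)
  show "gf4 (- 1) = 4 * psi * phi * dil psi * p ^ 4"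
    using gf4_rec[of "- 1" "- 1"] by (simp add: simps)
  show "gf4 2 = fps_X\<^sup>2 * (2 * dil (dil psi) * phi\<^sup>2 + 4 * dil phi * dil psi ^ 2) * p ^ 4"
    using gf4_rec[of 2 0] by (simp add: simps) (simp add: 4 algebra_simps power2_eq_square)
  show "gf4 (- 2) = (2 * dil (dil psi) * phi\<^sup>2 + 4 * dil phi * dil psi ^ 2) * p ^ 4"
    using gf4_rec[of "- 2" "- 1"] by (simp add: simps) (simp add: 4 algebra_simps power2_eq_square)
qed

text \<open>The window of first charges is -1, 0, 1, 2. Charges 1 and -1 contribute equally, charge
  0 gives the square of \<open>gf4 0\<close>, and charge 2 is paired with -2.\<close>

lemma gf8_0_eq:
  "gf8 0 = p ^ 8 * (dil (dil phi) * (dil phi * phi\<^sup>2 + 8 * fps_X * dil (dil psi) * dil psi ^ 2)\<^sup>2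
      + 32 * fps_X * psi\<^sup>2 * phi\<^sup>2 * dil psi ^ 3
      + 2 * fps_X\<^sup>2 * dil (dil (dil psi)) * (2 * dil (dil psi) * phi\<^sup>2 + 4 * dil phi * dil psi ^ 2)\<^sup>2)"
proof -
  have 8: "p ^ 8 = p ^ 4 * p ^ 4" by (simp add: power_add[symmetric])
  have "{-1..<3::int} = {-1, 0, 1, 2}" by auto
  then have "gf8 0 = dil (dil phi) * (gf4 0 * gf4 0) + 2 * dil psi * (gf4 1 * gf4 (- 1))
      + 2 * dil (dil (dil psi)) * (gf4 2 * gf4 (- 2))"
    using gf8_rec[of 0 "- 1"] by (simp add: theta_dilations theta_minus[of 4 2])
  then show ?thesis
    by (simp only: gf4_eq 8 power2_eq_square power3_eq_cube) (simp add: algebra_simps)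
qed

section \<open>Signed cancellation in pairs of Maya diagrams\<close>

text \<open>A sign-reversing involution on pairs of finite sets: transfer the least element of the
  symmetric difference from one component to the other. Only the diagonal survives.\<close>

definition transfer_min :: "int set \<times> int set \<Rightarrow> int set \<times> int set" where
  "transfer_min = (\<lambda>(X, Y). let m = Min (X - Y \<union> (Y - X)) in
     if m \<in> X then (X - {m}, insert m Y) else (insert m X, Y - {m}))"

text \<open>A transfer leaves the symmetric difference, and hence its least element, unchanged, so a
  second transfer undoes the first. The moved element has charge 1 or -1, which flips the parity of
  the first charge but keeps both totals.\<close>

lemma transfer_min:
  assumes "finite X" "finite Y" "X \<noteq> Y" "transfer_min (X, Y) = (X', Y')"
  shows "finite X'" "finite Y'" "X' \<noteq> Y'" "transfer_min (X', Y') = (X, Y)"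
    "charge X' + charge Y' = charge X + charge Y" "energy X' + energy Y' = energy X + energy Y"
    "even (charge X') \<longleftrightarrow> odd (charge X)"
proof -
  define m where "m = Min (X - Y \<union> (Y - X))"
  have "X - Y \<union> (Y - X) \<noteq> {}" using assms(3) by blast
  then have m: "m \<in> X - Y \<union> (Y - X)"
    using assms(1,2) unfolding m_def by (intro Min_in) auto
  consider "m \<in> X" "m \<notin> Y" "X' = X - {m}" "Y' = insert m Y"
    | "m \<notin> X" "m \<in> Y" "X' = insert m X" "Y' = Y - {m}"
    using assms(4) m unfolding transfer_min_def m_def[symmetric] Let_def prod.case
    by (auto split: if_splits)
  note cases = this
  show "finite X'" "finite Y'" using assms(1,2) by (cases rule: cases; simp)+
  have D: "X' - Y' \<union> (Y' - X') = X - Y \<union> (Y - X)"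
    by (cases rule: cases) auto
  then show "X' \<noteq> Y'" using m by blast
  have "transfer_min (X', Y') = (if m \<in> X' then (X' - {m}, insert m Y') else (insert m X', Y' - {m}))"
    unfolding transfer_min_def Let_def prod.case D m_def[symmetric] ..
  also have "\<dots> = (X, Y)"
    by (cases rule: cases) auto
  finally show "transfer_min (X', Y') = (X, Y)" .
  have charge_m: "charge (insert m Z) = charge1 m + charge Z" "energy (insert m Z) = nat \<bar>m\<bar> + energy Z"
    if "finite Z" "m \<notin> Z" for Z
    using that by (simp_all add: charge_def energy_def)
  have charge_m': "charge Z = charge1 m + charge (Z - {m})" "energy Z = nat \<bar>m\<bar> + energy (Z - {m})"
    if "finite Z" "m \<in> Z" for Z
    using that by (simp_all add: charge_def energy_def sum.remove)
  have *: "charge X' + charge Y' = charge X + charge Y \<and> energy X' + energy Y' = energy X + energy Y \<and>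
      (charge X = charge1 m + charge X' \<or> charge X' = charge1 m + charge X)"
  proof (cases rule: cases)
    case 1
    show ?thesis
      unfolding 1(3,4) using charge_m[OF assms(2) 1(2)] charge_m'[OF assms(1) 1(1)] by linarith
  next
    case 2
    show ?thesis
      unfolding 2(3,4) using charge_m[OF assms(1) 2(1)] charge_m'[OF assms(2) 2(2)] by linarith
  qed
  then show "charge X' + charge Y' = charge X + charge Y" "energy X' + energy Y' = energy X + energy Y"
    by blast+
  have "odd (charge1 m)" by (simp add: charge1_def)
  with * show "even (charge X') \<longleftrightarrow> odd (charge X)" by (metis even_add)
qed

lemma wgf_involution_zero:
  assumes "\<And>a. a \<in> A \<Longrightarrow> h a \<in> A" "\<And>a. a \<in> A \<Longrightarrow> h (h a) = a"
    and "\<And>a. a \<in> A \<Longrightarrow> w (h a) = w a" "\<And>a. a \<in> A \<Longrightarrow> s (h a) = - s a"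
  shows "wgf A w s = 0"
proof -
  have "bij_betw h A A"
    by (rule bij_betw_byWitness[of _ h]) (use assms in auto)
  then have "wgf A w s = fps_X ^ 0 * wgf A w (\<lambda>a. - s a)"
    by (rule wgf_bij) (use assms in auto)
  then have "wgf A w s = - wgf A w s" by (simp add: wgf_uminus)
  then show ?thesis by (simp add: fps_eq_iff)
qed

text \<open>The neutral pairs, signed by the parity of the first charge, are counted twice. Pairing
  by translations gives \<open>phim\<close> times \<open>p\<^sup>2\<close>; the involution leaves
  the diagonal, where the charge is 0 and the energy is doubled.\<close>

lemma p_square: "p\<^sup>2 * phim = dil p"
proof -
  let ?E = "{(X, Y) \<in> finsets2. charge X + charge Y = 0}"
  let ?D = "(\<lambda>X. (X, X)) ` {X \<in> finsets. charge X = 0}"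
  let ?s = "\<lambda>(X, Y :: int set). sgn_parity (charge X)"
  have "{0..<1::int} = {0}" by auto
  then have "wgf ?E energy2 ?s = phim * (p * p)"
    using f1.pairing[of 0 0 sgn_parity] by (simp add: p_def gf1_def phim_def)
  moreover have "wgf ?E energy2 ?s = wgf ?D energy2 ?s + wgf (?E - ?D) energy2 ?s"
  proof -
    have "?E = ?D \<union> (?E - ?D)" by auto
    then have "wgf ?E energy2 ?s = wgf (?D \<union> (?E - ?D)) energy2 ?s" by (simp only:)
    also have "\<dots> = wgf ?D energy2 ?s + wgf (?E - ?D) energy2 ?s"
      by (rule wgf_Un) (auto intro!: fin_fibres_subset[OF f2.fin])
    finally show ?thesis .
  qed
  moreover have "wgf (?E - ?D) energy2 ?s = 0"
  proof (rule wgf_involution_zero)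
    fix a assume a: "a \<in> ?E - ?D"
    obtain X Y where XY: "a = (X, Y)" by (cases a)
    with a have fin: "finite X" "finite Y" "charge X + charge Y = 0" "(X, Y) \<notin> ?D" by simp_all
    have ne: "X \<noteq> Y"
    proof
      assume "X = Y"
      with fin have "(X, Y) \<in> ?D" by simp
      with fin show False by blast
    qed
    obtain X' Y' where X'Y': "transfer_min (X, Y) = (X', Y')" by (cases "transfer_min (X, Y)")
    note * = transfer_min[OF fin(1,2) ne X'Y']
    show "transfer_min a \<in> ?E - ?D" using *(1-3,5) fin(3) XY X'Y' by auto
    show "transfer_min (transfer_min a) = a" using * XY X'Y' by simp
    show "energy2 (transfer_min a) = energy2 a" using * XY X'Y' by simp
    show "?s (transfer_min a) = - ?s a" using * XY X'Y' by simp
  qed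
  moreover have "wgf ?D energy2 ?s = dil p"
  proof -
    have "wgf ?D energy2 ?s = fps_X ^ 0 * wgf {X \<in> finsets. charge X = 0} (\<lambda>X. 2 * energy X) (\<lambda>_. 1)"
      by (rule wgf_bij[of "\<lambda>X. (X, X)"]) (auto simp: bij_betw_def inj_on_def)
    then show ?thesis by (simp add: wgf_dil p_def gf1_def charged_gf_def)
  qed
  ultimately show ?thesis by (simp add: power2_eq_square mult_ac)
qed

section \<open>Frobenius symbols as tuples of Maya diagrams\<close>

lemma bij_betw_restrict:
  assumes "bij_betw f A B" "A' \<subseteq> A" "B' \<subseteq> B" "\<And>a. a \<in> A \<Longrightarrow> f a \<in> B' \<longleftrightarrow> a \<in> A'"
  shows "bij_betw f A' B'"
proof -
  have "f ` A' = B'"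
  proof (intro equalityI subsetI)
    fix b assume "b \<in> B'"
    then obtain a where "a \<in> A" "b = f a" using assms(1,3) by (auto simp: bij_betw_def)
    then show "b \<in> f ` A'" using \<open>b \<in> B'\<close> assms(4) by blast
  qed (use assms in auto)
  then show ?thesis
    using assms(1,2) by (auto simp: bij_betw_def intro: inj_on_subset)
qed

text \<open>The order on colored integers is the lexicographic order on pairs, so strictly
  decreasing rows are reversed sorted lists.\<close>

lemma frobenius_row_iff:
  "frobenius_row k r \<longleftrightarrow> set r \<subseteq> UNIV \<times> {1..k} \<and> sorted_wrt (<) (rev r)"
  by (auto simp: frobenius_row_def sorted_wrt_rev colored_less_def less_prod_def' mem_Times_iff subset_iff
      intro: sorted_wrt_mono_rel)

lemma bij_betw_frobenius_row:
  "bij_betw set {r. frobenius_row k r} {S. finite S \<and> S \<subseteq> UNIV \<times> {1..k}}"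
proof (rule bij_betw_byWitness[of _ "\<lambda>S. rev (sorted_list_of_set S)"])
  show "\<forall>r\<in>{r. frobenius_row k r}. rev (sorted_list_of_set (set r)) = r"
  proof
    fix r assume "r \<in> {r. frobenius_row k r}"
    then have "sorted_wrt (<) (rev r)" by (simp add: frobenius_row_iff)
    then have "sorted_list_of_set (set (rev r)) = rev r"
      by (metis sorted_list_of_set.idem_if_sorted_distinct strict_sorted_iff)
    then show "rev (sorted_list_of_set (set r)) = r" by simp
  qed
qed (auto simp: frobenius_row_iff)

lemma frobenius_row_distinct: "frobenius_row k r \<Longrightarrow> distinct r"
  by (metis distinct_rev frobenius_row_iff strict_sorted_iff)

definition set_symbols :: "nat \<Rightarrow> nat \<Rightarrow> ((nat \<times> nat) set \<times> (nat \<times> nat) set) set" where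
  "set_symbols k n = {(S, T). finite S \<and> finite T \<and> S \<subseteq> UNIV \<times> {1..k} \<and> T \<subseteq> UNIV \<times> {1..k} \<and>
     card S = card T \<and> card S + (\<Sum>x\<in>S. fst x) + (\<Sum>x\<in>T. fst x) = n}"

lemma c_phi_eq_card_set_symbols: "c_phi k n = card (set_symbols k n)"
proof -
  let ?R = "{r. frobenius_row k r}" and ?S = "{S. finite S \<and> S \<subseteq> UNIV \<times> {1..k}}"
  have bij: "bij_betw (map_prod set set) (?R \<times> ?R) (?S \<times> ?S)"
    by (intro bij_betw_map_prod bij_betw_frobenius_row)
  have iff: "map_prod set set s \<in> set_symbols k n \<longleftrightarrow> s \<in> gen_frobenius_partitions k n"
    if sR: "s \<in> ?R \<times> ?R" for s
  proof -
    obtain a b where s: "s = (a, b)" "frobenius_row k a" "frobenius_row k b"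
      using sR by auto
    have "length a = card (set a)" "length b = card (set b)"
      using s(2,3) frobenius_row_distinct distinct_card by metis+
    moreover have "sum_list (map fst a) = (\<Sum>x\<in>set a. fst x)" "sum_list (map fst b) = (\<Sum>x\<in>set b. fst x)"
      using s(2,3) frobenius_row_distinct sum_list_distinct_conv_sum_set by blast+
    ultimately show ?thesis
      using s by (auto simp: gen_frobenius_partitions_def gen_frobenius_symbol_def symbol_size_def
          set_symbols_def frobenius_row_iff)
  qed
  have "bij_betw (map_prod set set) (gen_frobenius_partitions k n) (set_symbols k n)"
    by (rule bij_betw_restrict[OF bij _ _ iff])
       (auto simp: gen_frobenius_partitions_def gen_frobenius_symbol_def set_symbols_def)
  then show ?thesis
    by (simp add: c_phi_def bij_betw_same_card)
qed

text \<open>An entry \<open>l\<close> of the top row becomes the positive number \<open>l + 1\<close>, an entry \<open>l\<close> of the bottom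
  row the nonpositive number \<open>- l\<close>.\<close>

definition slice :: "(nat \<times> nat) set \<times> (nat \<times> nat) set \<Rightarrow> nat \<Rightarrow> int set" where
  "slice s c = (\<lambda>l. int l + 1) ` {l. (l, c) \<in> fst s} \<union> (\<lambda>l. - int l) ` {l. (l, c) \<in> snd s}"

lemma slice_iff: "int l + 1 \<in> slice s c \<longleftrightarrow> (l, c) \<in> fst s" "- int l \<in> slice s c \<longleftrightarrow> (l, c) \<in> snd s"
  by (auto simp: slice_def)

lemma finite_color_class: "finite S \<Longrightarrow> finite {l. (l, c) \<in> S}"
  by (rule finite_subset[of _ "fst ` S"]) (auto intro: image_eqI[rotated])

lemma sum_color_classes:
  fixes g :: "nat \<Rightarrow> 'b :: comm_monoid_add" and S :: "(nat \<times> nat) set"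
  assumes "finite S" "S \<subseteq> UNIV \<times> {1..k}"
  shows "(\<Sum>x\<in>S. g (fst x)) = (\<Sum>c=1..k. \<Sum>l | (l, c) \<in> S. g l)"
proof -
  have "(\<Sum>c=1..k. \<Sum>l | (l, c) \<in> S. g l) = (\<Sum>c=1..k. \<Sum>x | x \<in> S \<and> snd x = c. g (fst x))"
  proof (rule sum.cong[OF refl])
    fix c
    have "bij_betw (\<lambda>l. (l, c)) {l. (l, c) \<in> S} {x. x \<in> S \<and> snd x = c}"
      by (rule bij_betw_byWitness[of _ fst]) auto
    from sum.reindex_bij_betw[OF this, of "\<lambda>x. g (fst x)"]
    show "(\<Sum>l | (l, c) \<in> S. g l) = (\<Sum>x | x \<in> S \<and> snd x = c. g (fst x))" by simp
  qed
  also have "\<dots> = (\<Sum>x\<in>S. g (fst x))"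
    by (rule sum.group) (use assms in auto)
  finally show ?thesis ..
qed

text \<open>The images of the two rows are separated by sign. The shift by 1 in the top row makes
  each column contribute its extra unit to the size exactly once.\<close>

lemma charge_energy_slice:
  assumes "finite (fst s)" "finite (snd s)"
  shows "finite (slice s c)"
    "charge (slice s c) = (\<Sum>l | (l, c) \<in> fst s. 1) - (\<Sum>l | (l, c) \<in> snd s. 1)"
    "energy (slice s c) = (\<Sum>l | (l, c) \<in> fst s. l + 1) + (\<Sum>l | (l, c) \<in> snd s. l)"
proof -
  let ?A = "{l. (l, c) \<in> fst s}" and ?B = "{l. (l, c) \<in> snd s}"
  have fin: "finite ?A" "finite ?B" using assms by (simp_all add: finite_color_class)
  then show "finite (slice s c)" by (simp add: slice_def)
  have inj: "inj_on (\<lambda>l. int l + 1) ?A" "inj_on (\<lambda>l. - int l) ?B" by (auto simp: inj_on_def)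
  have disj: "(\<lambda>l. int l + 1) ` ?A \<inter> (\<lambda>l. - int l) ` ?B = {}" by auto
  have "charge (slice s c) = (\<Sum>l\<in>?A. charge1 (int l + 1)) + (\<Sum>l\<in>?B. charge1 (- int l))"
    unfolding charge_def slice_def
    by (subst sum.union_disjoint) (use fin inj disj in \<open>simp_all add: sum.reindex\<close>)
  then show "charge (slice s c) = (\<Sum>l | (l, c) \<in> fst s. 1) - (\<Sum>l | (l, c) \<in> snd s. 1)"
    by (simp add: charge1_def sum_negf)
  have "energy (slice s c) = (\<Sum>l\<in>?A. nat \<bar>int l + 1\<bar>) + (\<Sum>l\<in>?B. nat \<bar>- int l\<bar>)"
    unfolding energy_def slice_def
    by (subst sum.union_disjoint) (use fin inj disj in \<open>simp_all add: sum.reindex\<close>)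
  moreover have "nat \<bar>int l + 1\<bar> = l + 1" "nat \<bar>- int l\<bar> = l" for l by simp_all
  ultimately show "energy (slice s c) = (\<Sum>l | (l, c) \<in> fst s. l + 1) + (\<Sum>l | (l, c) \<in> snd s. l)"
    by (simp only:)
qed

text \<open>Values outside the colors are pinned to the empty set, so that a family is determined by
  its k components.\<close>

definition charged_families :: "nat \<Rightarrow> nat \<Rightarrow> (nat \<Rightarrow> int set) set" where
  "charged_families k n = {f. (\<forall>c\<in>{1..k}. finite (f c)) \<and> (\<forall>c. c \<notin> {1..k} \<longrightarrow> f c = {}) \<and>
     (\<Sum>c=1..k. charge (f c)) = 0 \<and> (\<Sum>c=1..k. energy (f c)) = n}"

text \<open>Every integer is either l + 1 or -l for a unique natural l, so the rows can be read
  back. Total charge 0 means equal row lengths, and total energy is the size of the symbol.\<close>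

lemma bij_betw_slice: "bij_betw slice (set_symbols k n) (charged_families k n)"
proof -
  let ?F = "{s. finite (fst s) \<and> finite (snd s) \<and> fst s \<subseteq> UNIV \<times> {1..k} \<and> snd s \<subseteq> UNIV \<times> {1..k}}"
  let ?G = "{f. (\<forall>c\<in>{1..k}. finite (f c)) \<and> (\<forall>c. c \<notin> {1..k} \<longrightarrow> f c = {})}"
  let ?u = "\<lambda>f. ({(l, c). int l + 1 \<in> f c}, {(l, c). - int l \<in> f c})"
  have bij: "bij_betw slice ?F ?G"
  proof (rule bij_betw_byWitness[of _ ?u])
    show "\<forall>s\<in>?F. ?u (slice s) = s"
      by (auto simp: slice_iff)
    show "\<forall>f\<in>?G. slice (?u f) = f"
    proof (intro ballI ext set_eqI)
      fix f :: "nat \<Rightarrow> int set" and c x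
      show "x \<in> slice (?u f) c \<longleftrightarrow> x \<in> f c"
      proof (cases "0 < x")
        case True
        then obtain l where "x = int l + 1" by (metis add.commute zero_less_imp_eq_int int_Suc Suc_pred)
        then show ?thesis by (simp add: slice_iff)
      next
        case False
        then obtain l where "x = - int l" by (metis not_less nonpos_int_cases)
        then show ?thesis by (simp add: slice_iff)
      qed
    qed
    show "slice ` ?F \<subseteq> ?G"
      by (auto simp: charge_energy_slice(1)) (auto simp: slice_def)
    show "?u ` ?G \<subseteq> ?F"
    proof (rule image_subsetI)
      fix f :: "nat \<Rightarrow> int set" assume f: "f \<in> ?G"
      have "{(l, c). int l + 1 \<in> f c} \<subseteq> (\<Union>c\<in>{1..k}. (\<lambda>x. (nat (x - 1), c)) ` f c)"
           "{(l, c). - int l \<in> f c} \<subseteq> (\<Union>c\<in>{1..k}. (\<lambda>x. (nat (- x), c)) ` f c)"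
        using f by (force simp: image_iff)+
      moreover have "finite (\<Union>c\<in>{1..k}. (\<lambda>x. (nat (x - 1), c)) ` f c)" "finite (\<Union>c\<in>{1..k}. (\<lambda>x. (nat (- x), c)) ` f c)"
        using f by auto
      ultimately have "finite {(l, c). int l + 1 \<in> f c}" "finite {(l, c). - int l \<in> f c}"
        using finite_subset by blast+
      then show "?u f \<in> ?F" using f by auto
    qed
  qed
  have iff: "slice s \<in> charged_families k n \<longleftrightarrow> s \<in> set_symbols k n" if s: "s \<in> ?F" for s
  proof -
    have fin: "finite (fst s)" "finite (snd s)" "fst s \<subseteq> UNIV \<times> {1..k}" "snd s \<subseteq> UNIV \<times> {1..k}"
      using s by auto
    have "(\<Sum>c=1..k. charge (slice s c)) = int (card (fst s)) - int (card (snd s))"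
      using sum_color_classes[OF fin(1,3), of "\<lambda>_. 1 :: int"] sum_color_classes[OF fin(2,4), of "\<lambda>_. 1 :: int"]
      by (simp add: charge_energy_slice[OF fin(1,2)] sum_subtractf)
    moreover have "(\<Sum>c=1..k. energy (slice s c)) = card (fst s) + (\<Sum>x\<in>fst s. fst x) + (\<Sum>x\<in>snd s. fst x)"
    proof -
      have "(\<Sum>c=1..k. energy (slice s c))
          = (\<Sum>c=1..k. \<Sum>l | (l, c) \<in> fst s. l + 1) + (\<Sum>c=1..k. \<Sum>l | (l, c) \<in> snd s. l)"
        by (simp only: charge_energy_slice(3)[OF fin(1,2)]) (rule sum.distrib)
      also have "\<dots> = (\<Sum>x\<in>fst s. fst x + 1) + (\<Sum>x\<in>snd s. fst x)"
        by (simp only: sum_color_classes[OF fin(1,3), of "\<lambda>l. l + 1"] sum_color_classes[OF fin(2,4), of "\<lambda>l. l"])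
      finally show ?thesis by (simp only: sum.distrib) simp
    qed
    ultimately show ?thesis
      using s bij_betwE[OF bij] by (cases s) (auto simp: charged_families_def set_symbols_def)
  qed
  show ?thesis
    by (rule bij_betw_restrict[OF bij _ _ iff]) (auto simp: set_symbols_def charged_families_def)
qed

text \<open>The bracketing follows the nested products created by the three doublings.\<close>

definition tuple_of_family :: "(nat \<Rightarrow> 'a) \<Rightarrow> (('a \<times> 'a) \<times> ('a \<times> 'a)) \<times> (('a \<times> 'a) \<times> ('a \<times> 'a))" where
  "tuple_of_family f = (((f 1, f 2), (f 3, f 4)), ((f 5, f 6), (f 7, f 8)))"

lemma bij_betw_tuple_of_family:
  "bij_betw tuple_of_family (charged_families 8 n)
     {x. x \<in> {x \<in> finsets4 \<times> finsets4. (case x of (a, b) \<Rightarrow> charge4 a + charge4 b) = 0}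
       \<and> (case x of (a, b) \<Rightarrow> energy4 a + energy4 b) = n}" (is "bij_betw _ _ ?T")
proof -
  let ?u = "\<lambda>(((a1, a2), (a3, a4)), ((a5, a6), (a7, a8))). \<lambda>c :: nat.
     if c = 1 then a1 else if c = 2 then a2 else if c = 3 then a3 else if c = 4 then a4
     else if c = 5 then a5 else if c = 6 then a6 else if c = 7 then a7 else if c = 8 then a8 else {}"
  have 8: "{1..8::nat} = {1, 2, 3, 4, 5, 6, 7, 8}" by auto
  note families = charged_families_def[of 8 n, unfolded 8]
  show ?thesis
  proof (rule bij_betw_byWitness[of _ ?u])
    show "\<forall>f\<in>charged_families 8 n. ?u (tuple_of_family f) = f"
      by (auto simp: families tuple_of_family_def fun_eq_iff)
    show "\<forall>x\<in>?T. tuple_of_family (?u x) = x"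
      by (auto simp: tuple_of_family_def)
    show "tuple_of_family ` charged_families 8 n \<subseteq> ?T"
      by (auto simp: families tuple_of_family_def add_ac)
    show "?u ` ?T \<subseteq> charged_families 8 n"
      by (auto simp: families add_ac)
  qed
qed

lemma c_phi_8_eq: "int (c_phi 8 n) = gf8 0 $ n"
  using bij_betw_same_card[OF bij_betw_slice[of 8 n]] bij_betw_same_card[OF bij_betw_tuple_of_family[of n]]
  by (simp add: c_phi_eq_card_set_symbols gf8_def charged_gf_def wgf_nth)

section \<open>Dissections\<close>

lemma phi_nth_0: "phi $ 0 = 1" and phim_nth_0: "phim $ 0 = 1"
proof -
  have "{j::int. nat (j\<^sup>2) = 0} = {0}" by auto
  then show "phi $ 0 = 1" "phim $ 0 = 1"
    by (simp_all add: phi_def phim_def theta_def wgf_nth)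
qed

text \<open>A power series with constant term 1 is invertible over the integers.\<close>

lemma dvd_cancel_unit:
  fixes f h :: "int fps"
  assumes "k dvd h * f" "h $ 0 = 1"
  shows "k dvd f"
proof -
  have "\<exists>k. 1 = k * h $ 0"
    using assms(2) by (intro exI[of _ 1]) simp
  then have "\<exists>g. 1 = g * h"
    by (simp only: fps_is_right_unit_iff_zeroth_is_right_unit)
  then obtain g where g: "1 = g * h" ..
  have "g * (h * f) = (g * h) * f" by (simp only: mult.assoc)
  also have "\<dots> = f" by (simp only: g[symmetric] mult_1)
  finally have "g * (h * f) = f" .
  then show ?thesis using dvd_mult[OF assms(1), of g] by (simp only:)
qed

text \<open>Changing the sign of the odd half of \<open>phi\<close> changes the square by four times
  the product of the halves; \<open>psi_square\<close>, dilated twice, turns that product into a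
  square.\<close>

lemma phim_square: "phim\<^sup>2 = dil phi ^ 2 - 4 * fps_X * dil (dil psi) ^ 2"
proof -
  have psi2: "dil (dil psi) ^ 2 = dil (dil (dil psi)) * dil (dil phi)"
    using arg_cong[OF psi_square, of "\<lambda>f. dil (dil f)"] by (simp add: dil_simps)
  have d: "(a - b)\<^sup>2 = (a + b)\<^sup>2 - 4 * (a * b)" for a b :: "int fps"
    by algebra
  have "phim\<^sup>2 = phi\<^sup>2 - 4 * (dil (dil phi) * (2 * fps_X * dil (dil (dil psi))))"
    unfolding phim_dissection d phi_dissection[symmetric] ..
  also have "\<dots> = dil phi ^ 2 - 4 * fps_X * dil (dil psi) ^ 2"
    unfolding phi_square psi2 by algebra
  finally show ?thesis .
qed

lemma phi_phim: "phi * phim = dil (phim\<^sup>2)"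
proof -
  have "phi * phim = dil (dil phi) ^ 2 - 4 * fps_X\<^sup>2 * dil (dil (dil psi)) ^ 2"
    using phi_dissection phim_dissection by algebra
  then show ?thesis
    by (simp add: phim_square dil_simps power_mult[symmetric])
qed

text \<open>This is the exchange used in every dissection below: an even unit turns
  \<open>p\<^sup>2\<close> into an even series at the cost of one factor \<open>phi\<close>.\<close>

lemma p_square_phim_square: "p\<^sup>2 * dil (phim\<^sup>2) = dil p * phi"
proof -
  have "p\<^sup>2 * dil (phim\<^sup>2) = (p\<^sup>2 * phim) * phi"
    unfolding phi_phim[symmetric] by (simp add: mult_ac)
  then show ?thesis by (simp only: p_square)
qed

lemma dil_psi_square: "dil psi ^ 2 = dil (dil psi) * dil phi"
  using arg_cong[OF psi_square, of dil] by (simp add: dil_simps)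

text \<open>The even and odd parts of \<open>phi ^ 4 * gf8 0 / p ^ 8\<close>.\<close>

abbreviation "phi4_even \<equiv> dil phi * (phi ^ 10 + 736 * fps_X * phi ^ 6 * dil psi ^ 4 + 4352 * fps_X\<^sup>2 * phi\<^sup>2 * dil psi ^ 8)
  + fps_X * dil (dil psi) * (136 * phi ^ 8 * dil psi ^ 2 + 5888 * fps_X * phi ^ 4 * dil psi ^ 6
  + 2048 * fps_X\<^sup>2 * dil psi ^ 10)"

abbreviation "phi4_odd \<equiv> 64 * (dil phi * phi ^ 8 * dil psi ^ 2 + 48 * fps_X * dil phi * phi ^ 4 * dil psi ^ 6
  + 24 * fps_X * dil (dil psi) * phi ^ 6 * dil psi ^ 4 + 128 * fps_X\<^sup>2 * dil (dil psi) * phi\<^sup>2 * dil psi ^ 8)"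

text \<open>In the application u and P are even series, v and Q odd ones. The right side is grouped
  accordingly: its first line is even, its second odd.\<close>

lemma uvPQ_expansion:
  fixes u v P Q :: "int fps"
  shows "(u + v)\<^sup>2 * (P * u * (u + 3 * v)\<^sup>2 + 8 * u * v * (u + v) * (P + Q) + Q * v * (3 * u + v)\<^sup>2)
    = P * (u ^ 5 + 46 * u ^ 3 * v\<^sup>2 + 17 * u * v ^ 4) + Q * (17 * u ^ 4 * v + 46 * u\<^sup>2 * v ^ 3 + v ^ 5)
    + (P * (16 * u ^ 4 * v + 48 * u\<^sup>2 * v ^ 3) + Q * (48 * u ^ 3 * v\<^sup>2 + 16 * u * v ^ 4))"
  by algebra

text \<open>Four exchanges replace \<open>p ^ 8\<close> by an even series times
  \<open>phi ^ 4\<close>. The remaining polynomial is expressed through the even and odd parts of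
  \<open>phi\<close> and \<open>phi\<^sup>2\<close> and then split.\<close>

lemma gf8_dissection: "dil (phim ^ 8) * gf8 0 = dil (p ^ 4 * phi4_even) + fps_X * dil (p ^ 4 * phi4_odd)"
proof -
  \<comment> \<open>These are the even and odd parts in phi^2 = u + v and phi = P + Q.\<close>
  define u v P Q where "u = dil phi ^ 2" and "v = 4 * fps_X * dil (dil psi) ^ 2"
    and "P = dil (dil phi)" and "Q = 2 * fps_X * dil (dil (dil psi))"
  have phi: "phi = P + Q" "phi\<^sup>2 = u + v"
    using phi_dissection phi_square by (simp_all only: u_def v_def P_def Q_def)
  define T where "T = dil (dil phi) * (dil phi * phi\<^sup>2 + 8 * fps_X * dil (dil psi) * dil psi ^ 2)\<^sup>2
      + 32 * fps_X * psi\<^sup>2 * phi\<^sup>2 * dil psi ^ 3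
      + 2 * fps_X\<^sup>2 * dil (dil (dil psi)) * (2 * dil (dil psi) * phi\<^sup>2 + 4 * dil phi * dil psi ^ 2)\<^sup>2"
  have "32 * fps_X * psi\<^sup>2 * phi\<^sup>2 * dil psi ^ 3 = 32 * fps_X * phi\<^sup>2 * phi * (dil psi ^ 2)\<^sup>2"
    unfolding psi_square by algebra
  also have "\<dots> = 8 * u * v * phi\<^sup>2 * phi"
    unfolding dil_psi_square u_def v_def by algebra
  finally have t2: "32 * fps_X * psi\<^sup>2 * phi\<^sup>2 * dil psi ^ 3 = 8 * u * v * (u + v) * (P + Q)"
    by (simp only: phi(2) phi(1)[symmetric])
  have t1: "dil (dil phi) * (dil phi * phi\<^sup>2 + 8 * fps_X * dil (dil psi) * dil psi ^ 2)\<^sup>2 = P * u * (u + 3 * v)\<^sup>2"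
    unfolding phi(2) dil_psi_square unfolding u_def v_def P_def by algebra
  have t3: "2 * fps_X\<^sup>2 * dil (dil (dil psi)) * (2 * dil (dil psi) * phi\<^sup>2 + 4 * dil phi * dil psi ^ 2)\<^sup>2
      = Q * v * (3 * u + v)\<^sup>2"
    unfolding phi(2) dil_psi_square unfolding u_def v_def Q_def by algebra
  have "phi ^ 4 * T = (u + v)\<^sup>2 * (P * u * (u + 3 * v)\<^sup>2 + 8 * u * v * (u + v) * (P + Q) + Q * v * (3 * u + v)\<^sup>2)"
    unfolding T_def t1 t2 t3 phi(2)[symmetric] by algebra
  also have "\<dots> = dil phi4_even + fps_X * dil phi4_odd"
    unfolding uvPQ_expansion unfolding u_def v_def P_def Q_def dil_simps by algebra
  finally have G: "phi ^ 4 * T = dil phi4_even + fps_X * dil phi4_odd" .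
  have "gf8 0 = p ^ 8 * T" unfolding T_def by (rule gf8_0_eq)
  then have "dil (phim ^ 8) * gf8 0 = (p\<^sup>2 * dil (phim\<^sup>2)) ^ 4 * T"
    unfolding dil_power by algebra
  also have "\<dots> = dil (p ^ 4) * (phi ^ 4 * T)"
    unfolding p_square_phim_square unfolding dil_power by algebra
  also have "\<dots> = dil (p ^ 4 * phi4_even) + fps_X * dil (p ^ 4 * phi4_odd)"
    unfolding G dil_mult[of "p ^ 4"] by algebra
  finally show ?thesis .
qed

text \<open>Repeated squaring of f^2 = U + 4 Y, with \<open>A\<close> and \<open>B\<close>
  collecting multiples of 64. In the application U is even and Y odd, so the result displays the
  even and odd parts modulo 64.\<close>

lemma phi_powers_expansion:
  fixes f U Y :: "int fps"
  assumes "f\<^sup>2 = U + 4 * Y"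
  obtains Z where "f ^ 20 + 32 * Y * U * f ^ 16 + 8 * Y * f ^ 18 = U ^ 10 + 80 * Y * U ^ 9 + 304 * Y\<^sup>2 * U ^ 8 + 64 * Z"
proof -
  define A where "A = U\<^sup>2 * Y\<^sup>2 + 4 * U * Y ^ 3 + 4 * Y ^ 4"
  have 8: "f ^ 8 = U ^ 4 + 16 * U ^ 3 * Y + 32 * U\<^sup>2 * Y\<^sup>2 + 64 * A"
  proof -
    have "f ^ 8 = (f\<^sup>2) ^ 4" by (simp add: power_mult[symmetric])
    also have "\<dots> = U ^ 4 + 16 * U ^ 3 * Y + 32 * U\<^sup>2 * Y\<^sup>2 + 64 * A"
      unfolding assms A_def by algebra
    finally show ?thesis .
  qed
  define B where "B = 5 * U ^ 6 * Y\<^sup>2 + 16 * U ^ 5 * Y ^ 3 + 16 * U ^ 4 * Y ^ 4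
     + 2 * A * (U ^ 4 + 16 * U ^ 3 * Y + 32 * U\<^sup>2 * Y\<^sup>2) + 64 * A\<^sup>2"
  have 16: "f ^ 16 = U ^ 8 + 32 * U ^ 7 * Y + 64 * B"
  proof -
    have "f ^ 16 = (f ^ 8)\<^sup>2" by (simp add: power_mult[symmetric])
    also have "\<dots> = U ^ 8 + 32 * U ^ 7 * Y + 64 * B"
      unfolding 8 B_def by algebra
    finally show ?thesis .
  qed
  have "f ^ 20 + 32 * Y * U * f ^ 16 + 8 * Y * f ^ 18 = f ^ 16 * ((f\<^sup>2)\<^sup>2 + 32 * Y * U + 8 * Y * f\<^sup>2)"
    by algebra
  also have "\<dots> = U ^ 10 + 80 * Y * U ^ 9 + 304 * Y\<^sup>2 * U ^ 8
      + 64 * (B * ((f\<^sup>2)\<^sup>2 + 32 * Y * U + 8 * Y * f\<^sup>2) + 20 * U ^ 8 * Y\<^sup>2 + 24 * U ^ 7 * Y ^ 3)"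
    unfolding 16 assms by algebra
  finally show ?thesis by (rule that)
qed

lemma dvd_power_diff:
  fixes a b :: "'a :: comm_ring_1"
  assumes "m dvd a - b"
  shows "m dvd a ^ k - b ^ k"
proof (induction k)
  case (Suc k)
  have "a ^ Suc k - b ^ Suc k = a * (a ^ k - b ^ k) + (a - b) * b ^ k"
    by (simp add: algebra_simps)
  then show ?case using Suc assms by (metis dvd_add dvd_mult dvd_mult2)
qed simp

lemma gf8_odd_dvd: "64 dvd odd_part (gf8 0)"
proof -
  have "phim ^ 8 * odd_part (gf8 0) = p ^ 4 * phi4_odd"
    using arg_cong[OF gf8_dissection, of odd_part] unfolding odd_part_dil_mult odd_part_dil .
  then have "64 dvd phim ^ 8 * odd_part (gf8 0)" by (simp only:) (intro dvd_mult dvd_triv_left)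
  then show ?thesis by (rule dvd_cancel_unit) (simp add: fps_power_zeroth phim_nth_0)
qed

section \<open>Dissection of the even-indexed coefficients\<close>

definition gf8_even :: "int fps" where "gf8_even = even_part (gf8 0)"

lemma gf8_even_dissection:
  obtains M where "dil (phim ^ 20) * gf8_even = dil (p\<^sup>2 * (phi ^ 21 + 304 * fps_X * phi ^ 17 * dil psi ^ 4))
      + fps_X * dil (p\<^sup>2 * (80 * phi ^ 19 * dil psi ^ 2)) + 64 * (dil (p\<^sup>2) * M)"
proof -
  define U Y W where "U = dil phi ^ 2" and "Y = fps_X * W" and "W = dil (dil psi) ^ 2"
  have phi2: "phi\<^sup>2 = U + 4 * Y"
    unfolding U_def Y_def W_def using phi_square by (simp add: mult_ac)
  obtain Z where Z: "phi ^ 20 + 32 * Y * U * phi ^ 16 + 8 * Y * phi ^ 18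
      = U ^ 10 + 80 * Y * U ^ 9 + 304 * Y\<^sup>2 * U ^ 8 + 64 * Z"
    using phi_powers_expansion[OF phi2] .
  have psi4: "dil psi ^ 4 = W * U"
  proof -
    have "dil psi ^ 4 = (dil psi ^ 2)\<^sup>2" by (simp add: power_mult[symmetric])
    then show ?thesis unfolding dil_psi_square U_def W_def by (simp add: power_mult_distrib)
  qed
  \<comment> \<open>The coefficients of \<open>phi4_even\<close> are reduced modulo 64: 736 = 32 +
    64 * 11 and 136 = 8 + 64 * 2, while 4352, 5888 and 2048 are multiples of 64.\<close>
  define M1 where "M1 = 11 * fps_X * dil phi * phi ^ 16 * dil psi ^ 4 + 68 * fps_X\<^sup>2 * dil phi * phi ^ 12 * dil psi ^ 8
    + fps_X * dil (dil psi) * (2 * phi ^ 18 * dil psi ^ 2 + 92 * fps_X * phi ^ 14 * dil psi ^ 6 + 32 * fps_X\<^sup>2 * phi ^ 10 * dil psi ^ 10)"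
  have "phi ^ 10 * phi4_even = dil phi * phi ^ 20 + 32 * fps_X * dil phi * phi ^ 16 * dil psi ^ 4
      + 8 * fps_X * dil (dil psi) * dil psi ^ 2 * phi ^ 18 + 64 * M1"
    unfolding M1_def by algebra
  also have "\<dots> = dil phi * (phi ^ 20 + 32 * Y * U * phi ^ 16 + 8 * Y * phi ^ 18) + 64 * M1"
    unfolding psi4 dil_psi_square Y_def W_def by algebra
  also have "\<dots> = dil phi * (U ^ 10 + 304 * Y\<^sup>2 * U ^ 8) + fps_X * (80 * dil phi * W * U ^ 9) + 64 * (dil phi * Z + M1)"
    unfolding Z unfolding Y_def by algebra
  also have "dil phi * (U ^ 10 + 304 * Y\<^sup>2 * U ^ 8) = dil (phi ^ 21 + 304 * fps_X * phi ^ 17 * dil psi ^ 4)"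
    unfolding U_def Y_def W_def dil_simps by algebra
  also have "80 * dil phi * W * U ^ 9 = dil (80 * phi ^ 19 * dil psi ^ 2)"
    unfolding U_def W_def dil_simps by algebra
  finally have K: "phi ^ 10 * phi4_even = dil (phi ^ 21 + 304 * fps_X * phi ^ 17 * dil psi ^ 4)
      + fps_X * dil (80 * phi ^ 19 * dil psi ^ 2) + 64 * (dil phi * Z + M1)" .
  have gf8_even: "phim ^ 8 * gf8_even = p ^ 4 * phi4_even"
    using arg_cong[OF gf8_dissection, of even_part] unfolding even_part_dil_mult even_part_dil gf8_even_def .
  \<comment> \<open>The unit is split so that it first cancels the earlier factor
    \<open>phim ^ 8\<close>, then performs two exchanges on \<open>p ^ 4\<close>. The leftover
    \<open>phi ^ 8\<close> and the two factors gained make up \<open>phi ^ 10\<close>.\<close>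
  have "dil (phim ^ 20) = (phi * phim) ^ 8 * dil (phim\<^sup>2) ^ 2"
    unfolding phi_phim unfolding dil_power by algebra
  then have "dil (phim ^ 20) * gf8_even = (phim ^ 8 * gf8_even) * (phi ^ 8 * dil (phim\<^sup>2) ^ 2)"
    by algebra
  also have "\<dots> = (p\<^sup>2 * dil (phim\<^sup>2))\<^sup>2 * (phi ^ 8 * phi4_even)"
    unfolding gf8_even by algebra
  also have "\<dots> = dil (p\<^sup>2) * (phi ^ 10 * phi4_even)"
    unfolding p_square_phim_square unfolding dil_power by algebra
  also have "\<dots> = dil (p\<^sup>2 * (phi ^ 21 + 304 * fps_X * phi ^ 17 * dil psi ^ 4))
      + fps_X * dil (p\<^sup>2 * (80 * phi ^ 19 * dil psi ^ 2)) + 64 * (dil (p\<^sup>2) * (dil phi * Z + M1))"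
    unfolding K dil_mult[of "p\<^sup>2"] by algebra
  finally show ?thesis by (rule that)
qed

lemma odd_part_numeral_mult: "odd_part (numeral k * f) = numeral k * odd_part f"
  and even_part_numeral_mult: "even_part (numeral k * f) = numeral k * even_part f"
  using odd_part_dil_mult[of "numeral k" f] even_part_dil_mult[of "numeral k" f] by (simp_all add: dil_numeral)

lemma odd_part_dil_zero: "odd_part (dil f) = 0"
  using odd_part_dil[of f 0] by (simp add: dil_def)

text \<open>Both squares differ from the even series \<open>dil phi ^ 2\<close> by a multiple of 4,
  and congruences pass to powers.\<close>

lemma powers_mod_4:
  obtains R S where "phi ^ (2 * k) = dil (phi ^ (2 * k)) + 4 * R" "phim ^ (2 * k) = dil (phi ^ (2 * k)) + 4 * S"
proof -
  have "4 dvd phi\<^sup>2 - dil phi ^ 2" "4 dvd phim\<^sup>2 - dil phi ^ 2"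
    unfolding phi_square phim_square by (simp_all add: mult.assoc)
  then have "4 dvd (phi\<^sup>2) ^ k - (dil phi ^ 2) ^ k" "4 dvd (phim\<^sup>2) ^ k - (dil phi ^ 2) ^ k"
    by (simp_all only: dvd_power_diff)
  then obtain R S where "(phi\<^sup>2) ^ k - (dil phi ^ 2) ^ k = 4 * R" "(phim\<^sup>2) ^ k - (dil phi ^ 2) ^ k = 4 * S"
    by (auto elim!: dvdE)
  note RS = this
  show ?thesis
  proof (rule that[of R S])
    show "phi ^ (2 * k) = dil (phi ^ (2 * k)) + 4 * R"
      unfolding power_mult dil_power using RS(1) by (metis add.commute diff_add_cancel)
    show "phim ^ (2 * k) = dil (phi ^ (2 * k)) + 4 * S"
      unfolding power_mult dil_power using RS(2) by (metis add.commute diff_add_cancel)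
  qed
qed

text \<open>Multiplying by \<open>phi * phim\<close>, a dilation, turns \<open>p\<^sup>2\<close> into \<open>dil p * phi\<close>. Modulo 4 the even powers of
  \<open>phi\<close> and \<open>phim\<close> are dilations as well, so that nothing odd survives.\<close>

lemma odd_part_dvd_4:
  assumes "phim ^ 20 * B = p\<^sup>2 * (c * phi ^ (2 * k + 1) * dil h + 4 * M)" "c = dil c'"
  shows "4 dvd odd_part B"
proof -
  obtain R where R: "phim ^ 20 = dil (phi ^ 20) + 4 * R"
    using powers_mod_4[of 10] by auto
  define f where "f = phi ^ (2 * (k + 1))"
  obtain S where S: "f = dil f + 4 * S"
    using powers_mod_4[of "k + 1"] unfolding f_def by blast
  \<comment> \<open>The factor gained from the exchange makes the odd exponent even.\<close>
  have f: "phi * phi ^ (2 * k + 1) = f"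
    by (simp add: f_def)
  have "dil (phim\<^sup>2) * (phim ^ 20 * B) = (p\<^sup>2 * dil (phim\<^sup>2)) * (c * phi ^ (2 * k + 1) * dil h + 4 * M)"
    unfolding assms(1) by (simp only: mult_ac)
  also have "\<dots> = dil p * (c * (phi * phi ^ (2 * k + 1)) * dil h + 4 * (phi * M))"
    unfolding p_square_phim_square by (simp only: distrib_left mult_ac)
  also have "\<dots> = dil p * (c * (dil f + 4 * S) * dil h + 4 * (phi * M))"
    unfolding f by (rule arg_cong[OF S])
  also have "\<dots> = dil (p * c' * f * h) + 4 * (dil p * (c * S * dil h + phi * M))"
    unfolding assms(2) dil_mult by (simp add: algebra_simps)
  finally have "dil (phim\<^sup>2) * (phim ^ 20 * B) = \<dots>" .
  moreover have "dil (phim\<^sup>2) * (phim ^ 20 * B) = dil (phim\<^sup>2 * phi ^ 20) * B + 4 * (dil (phim\<^sup>2) * R * B)"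
    unfolding R dil_mult by (simp add: algebra_simps)
  ultimately have "dil (phim\<^sup>2 * phi ^ 20) * B
      = dil (p * c' * f * h) + 4 * (dil p * (c * S * dil h + phi * M) - dil (phim\<^sup>2) * R * B)"
    by (simp add: algebra_simps)
  from arg_cong[OF this, of odd_part]
  have "4 dvd phim\<^sup>2 * phi ^ 20 * odd_part B"
    by (simp only: odd_part_dil_mult odd_part_add odd_part_dil_zero odd_part_numeral_mult add_0 dvd_triv_left)
  then show ?thesis
    by (rule dvd_cancel_unit) (simp add: fps_power_zeroth phi_nth_0 phim_nth_0)
qed

text \<open>The odd part carries 80 = 16 * 5 besides multiples of 64. After division by 16 only an
  odd power of \<open>phi\<close> times even factors survives modulo 4, so its own odd part gains
  another 4. In the even part 304 vanishes modulo 4, leaving \<open>phi ^ 21\<close>.\<close>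

lemma gf8_even_dvd: "16 dvd odd_part gf8_even" "4 dvd odd_part (even_part gf8_even)" "64 dvd odd_part (odd_part gf8_even)"
proof -
  obtain M where M: "dil (phim ^ 20) * gf8_even = dil (p\<^sup>2 * (phi ^ 21 + 304 * fps_X * phi ^ 17 * dil psi ^ 4))
      + fps_X * dil (p\<^sup>2 * (80 * phi ^ 19 * dil psi ^ 2)) + 64 * (dil (p\<^sup>2) * M)"
    using gf8_even_dissection .
  have "phim ^ 20 * odd_part gf8_even = p\<^sup>2 * (80 * phi ^ 19 * dil psi ^ 2) + 64 * (p\<^sup>2 * odd_part M)"
    using arg_cong[OF M, of odd_part] unfolding odd_part_add[of "_ + _"] odd_part_dil odd_part_dil_mult odd_part_numeral_mult .
  then have o: "phim ^ 20 * odd_part gf8_even = 16 * (p\<^sup>2 * (5 * phi ^ 19 * dil psi ^ 2 + 4 * odd_part M))"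
    by (simp add: algebra_simps)
  then have "16 dvd phim ^ 20 * odd_part gf8_even" by simp
  then show "16 dvd odd_part gf8_even"
    by (rule dvd_cancel_unit) (simp add: fps_power_zeroth phim_nth_0)
  then obtain B where B: "odd_part gf8_even = 16 * B" by (auto elim!: dvdE)
  have "16 * (phim ^ 20 * B) = 16 * (p\<^sup>2 * (5 * phi ^ 19 * dil psi ^ 2 + 4 * odd_part M))"
    using o unfolding B by (simp only: mult.left_commute)
  then have "phim ^ 20 * B = p\<^sup>2 * (5 * phi ^ (2 * 9 + 1) * dil (psi ^ 2) + 4 * odd_part M)"
    by (simp add: dil_power)
  then have "4 dvd odd_part B" by (rule odd_part_dvd_4[where c' = 5]) (simp add: dil_numeral)
  then obtain C where "odd_part B = 4 * C" by (auto elim!: dvdE)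
  then have "odd_part (odd_part gf8_even) = 64 * C" by (simp add: B odd_part_numeral_mult)
  then show "64 dvd odd_part (odd_part gf8_even)" by simp
  have "phim ^ 20 * even_part gf8_even = p\<^sup>2 * (phi ^ 21 + 304 * fps_X * phi ^ 17 * dil psi ^ 4) + 64 * (p\<^sup>2 * even_part M)"
    using arg_cong[OF M, of even_part] unfolding even_part_add[of "_ + _"] even_part_dil even_part_dil_mult even_part_numeral_mult .
  then have "phim ^ 20 * even_part gf8_even = p\<^sup>2 * (1 * phi ^ (2 * 10 + 1) * dil 1 + 4 * (76 * fps_X * phi ^ 17 * dil psi ^ 4 + 16 * even_part M))"
    by (simp add: dil_1 algebra_simps)
  then show "4 dvd odd_part (even_part gf8_even)" by (rule odd_part_dvd_4[where c' = 1]) (simp add: dil_1)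
qed

theorem theorem6p4:
  fixes n :: nat
  shows "[c_phi 8 (2 * n + 1) = 0] (mod 64) \<and>
         [c_phi 8 (4 * n + 2) = 0] (mod 16) \<and>
         [c_phi 8 (8 * n + 4) = 0] (mod 4) \<and>
         [c_phi 8 (8 * n + 6) = 0] (mod 64)"
proof -
  have dvd: "numeral k dvd c_phi 8 m" if "numeral k dvd gf8 0 $ m" for k m
  proof -
    have "int (numeral k) dvd int (c_phi 8 m)"
      using that by (simp add: c_phi_8_eq)
    then show ?thesis by (simp only: int_dvd_int_iff)
  qed
  have nth: "numeral k dvd f $ n" if "numeral k dvd f" for k and f :: "int fps"
    using that by (simp add: numeral_dvd_fps_iff)
  have "64 dvd gf8 0 $ (2 * n + 1)"
    using nth[OF gf8_odd_dvd] by (simp only: odd_part_def fps_nth_Abs_fps)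
  moreover have "16 dvd gf8 0 $ (4 * n + 2)"
  proof -
    have "4 * n + 2 = 2 * (2 * n + 1)" by simp
    then show ?thesis
      using nth[OF gf8_even_dvd(1)] by (simp only: odd_part_def even_part_def gf8_even_def fps_nth_Abs_fps)
  qed
  moreover have "4 dvd gf8 0 $ (8 * n + 4)"
  proof -
    have "8 * n + 4 = 2 * (2 * (2 * n + 1))" by simp
    then show ?thesis
      using nth[OF gf8_even_dvd(2)] by (simp only: odd_part_def even_part_def gf8_even_def fps_nth_Abs_fps)
  qed
  moreover have "64 dvd gf8 0 $ (8 * n + 6)"
  proof -
    \<comment> \<open>Read from the outside, the index says: even part, then odd part, then odd
      part.\<close>
    have "8 * n + 6 = 2 * (2 * (2 * n + 1) + 1)" by simp
    then show ?thesis
      using nth[OF gf8_even_dvd(3)] by (simp only: odd_part_def even_part_def gf8_even_def fps_nth_Abs_fps)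
  qed
  ultimately show ?thesis
    unfolding cong_0_iff by (intro conjI dvd)
qed

end
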